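(* Let $X$ be a smooth manifold, let $M\to X$ be the bundle of pseudo-Riemannian metrics of a fixed signature and let $p\ge 1$. If $T\colon J^2M\to\otimes^pTX$ is a non-zero, second-order, natural tensor that is divergence-free, then it has an even number of indices, i.e. $p$ is even.
   Context: $X$ is a smooth manifold; $M\to X$ is the bundle of pseudo-Riemannian metrics of a fixed signature; $J^2M$ is the bundle of 2-jets of sections of $M$. A second-order $p$-tensor is a smooth morphism of bundles $T\colon J^2M\to\otimes^pTX$ (over the identity of $X$); for a metric $g$, $T(g)$ is the contravariant tensor field $x\mapsto T(j^2_xg)$. It is natural if $T(\tau\cdot j^2_xg)=\tau_*T(j^2_xg)$ for every diffeomorphism $\tau\colon U\to V$ between open sets of $X$ and every metric $g$ (of the fixed signature) near $x\in U$, where $\tau\cdot j^2_xg:=j^2_{\tau(x)}(\tau_*g)$. Divergence: $(\mathrm{div}\,T)(g)^{j_1\ldots j_{p-1}}=\nabla_kT(g)^{j_1\ldots j_{p-1}k}$, with $\nabla$ the Levi-Civita connection of $g$. $T$ is divergence-free if $(\mathrm{div}\,T)(g)=0$ for every metric $g$ (of the fixed signature, on any open set). *)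

theory Defs
  imports "HOL-Analysis.Analysis"
begin

section \<open>Smooth maps between Euclidean spaces\<close>

text \<open>
  \<open>Ck_on\<close> and \<open>smooth_on\<close> are meant for open sets in finite-dimensional spaces, where
  \<open>C\<^sup>k\<close> regularity may be tested on iterated directional derivatives.
\<close>

primrec Ck_on :: "nat \<Rightarrow> 'e::real_normed_vector set \<Rightarrow> ('e \<Rightarrow> 'f::real_normed_vector) \<Rightarrow> bool" where
  "Ck_on 0 S f \<longleftrightarrow> continuous_on S f"
| "Ck_on (Suc k) S f \<longleftrightarrow>
     (\<forall>x\<in>S. f differentiable (at x)) \<and> (\<forall>v. Ck_on k S (\<lambda>x. frechet_derivative f (at x) v))"

definition smooth_on :: "'e::real_normed_vector set \<Rightarrow> ('e \<Rightarrow> 'f::real_normed_vector) \<Rightarrow> bool" where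
  "smooth_on S f \<longleftrightarrow> (\<forall>k. Ck_on k S f)"

text \<open>
  Smoothness on a set that need not be open: local smooth extendability. It is needed for
  functions of jets, whose coordinates (symmetric matrices etc.) range over an open subset of a
  proper linear subspace.
\<close>

definition smooth_on_subset :: "'e::real_normed_vector set \<Rightarrow> ('e \<Rightarrow> 'f::real_normed_vector) \<Rightarrow> bool" where
  "smooth_on_subset S f \<longleftrightarrow>
     (\<forall>x\<in>S. \<exists>W h. open W \<and> x \<in> W \<and> smooth_on W h \<and> (\<forall>y\<in>W \<inter> S. h y = f y))"

definition pd :: "'n::finite \<Rightarrow> (real^'n \<Rightarrow> 'f::real_normed_vector) \<Rightarrow> real^'n \<Rightarrow> 'f" where
  "pd k f y = frechet_derivative f (at y) (axis k 1)"


section \<open>Smooth manifolds\<close>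

text \<open>
  A chart is a pair of its domain and its coordinate map, the values of the latter outside the
  domain being irrelevant. An atlas need not be maximal; all notions below only depend on the
  smooth structure that it generates.
\<close>

type_synonym ('a, 'n) chart = "'a set \<times> ('a \<Rightarrow> real^'n)"

definition cinv :: "('a, 'n::finite) chart \<Rightarrow> real^'n \<Rightarrow> 'a" where
  "cinv c = inv_into (fst c) (snd c)"

definition smooth_manifold :: "'a topology \<Rightarrow> ('a, 'n::finite) chart set \<Rightarrow> bool" where
  "smooth_manifold X A \<longleftrightarrow>
     Hausdorff_space X \<and> second_countable X \<and>
     (\<forall>c\<in>A. openin X (fst c) \<and> open (snd c ` fst c) \<and>
        homeomorphic_map (subtopology X (fst c)) (top_of_set (snd c ` fst c)) (snd c)) \<and>
     (\<Union>c\<in>A. fst c) = topspace X \<and>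
     (\<forall>c\<in>A. \<forall>d\<in>A. smooth_on (snd c ` (fst c \<inter> fst d)) (snd d \<circ> cinv c))"

definition charts_at :: "('a, 'n::finite) chart set \<Rightarrow> 'a \<Rightarrow> ('a, 'n) chart set" where
  "charts_at A x = {c \<in> A. x \<in> fst c}"

definition chart_at :: "('a, 'n::finite) chart set \<Rightarrow> 'a \<Rightarrow> ('a, 'n) chart" where
  "chart_at A x = (SOME c. c \<in> charts_at A x)"

definition smooth_map_on :: "('a, 'n::finite) chart set \<Rightarrow> 'a set \<Rightarrow> ('a \<Rightarrow> 'a) \<Rightarrow> bool" where
  "smooth_map_on A U \<tau> \<longleftrightarrow>
     (\<forall>c\<in>A. \<forall>d\<in>A. smooth_on (snd c ` {x \<in> U. x \<in> fst c \<and> \<tau> x \<in> fst d}) (snd d \<circ> \<tau> \<circ> cinv c))"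

definition diffeo ::
    "'a topology \<Rightarrow> ('a, 'n::finite) chart set \<Rightarrow> 'a set \<Rightarrow> 'a set \<Rightarrow> ('a \<Rightarrow> 'a) \<Rightarrow> bool" where
  "diffeo X A U V \<tau> \<longleftrightarrow>
     openin X U \<and> openin X V \<and>
     homeomorphic_map (subtopology X U) (subtopology X V) \<tau> \<and>
     smooth_map_on A U \<tau> \<and> smooth_map_on A V (inv_into U \<tau>)"

text \<open>
  The Jacobian matrix at \<open>x\<close> of \<open>\<tau>\<close> in the charts \<open>c\<close> at \<open>x\<close> and \<open>d\<close> at \<open>\<tau> x\<close>. For \<open>\<tau> = id\<close> it
  is the Jacobian of the change of coordinates from \<open>c\<close> to \<open>d\<close>.
\<close>

definition jac :: "('a \<Rightarrow> 'a) \<Rightarrow> ('a, 'n::finite) chart \<Rightarrow> ('a, 'n) chart \<Rightarrow> 'a \<Rightarrow> real^'n^'n" where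
  "jac \<tau> c d x = matrix (frechet_derivative (snd d \<circ> \<tau> \<circ> cinv c) (at (snd c x)))"


section \<open>Contravariant tensors\<close>

text \<open>
  An element of \<open>\<otimes>\<^sup>p T\<^sub>x X\<close> is a family of components, one system of components for each chart at
  \<open>x\<close>, obeying the transformation law under changes of charts. A multi-index \<open>(i\<^sub>1,\<dots>,i\<^sub>p)\<close> is a
  list of length \<open>p\<close>; components at other charts or lists are fixed to be \<open>0\<close>, so that equality
  of tensors is equality of functions.
\<close>

type_synonym ('a, 'n) tensor = "('a, 'n) chart \<Rightarrow> 'n list \<Rightarrow> real"

definition transform :: "nat \<Rightarrow> real^'n^'n \<Rightarrow> ('n::finite list \<Rightarrow> real) \<Rightarrow> 'n list \<Rightarrow> real" where
  "transform p M t I = (\<Sum>J | length J = p. (\<Prod>k<p. M $ (I ! k) $ (J ! k)) * t J)"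

definition tensors_at :: "('a, 'n::finite) chart set \<Rightarrow> nat \<Rightarrow> 'a \<Rightarrow> ('a, 'n) tensor set" where
  "tensors_at A p x =
     {t. (\<forall>c I. \<not> (c \<in> charts_at A x \<and> length I = p) \<longrightarrow> t c I = 0) \<and>
         (\<forall>c\<in>charts_at A x. \<forall>d\<in>charts_at A x. \<forall>I. length I = p \<longrightarrow>
            t d I = transform p (jac id c d x) (t c) I)}"

text \<open>
  Push-forward of a tensor at \<open>x\<close> to \<open>\<tau> x\<close>. By the transformation law, the choice of the chart
  at \<open>x\<close> is irrelevant; the same applies to the push-forward of metrics below.
\<close>

definition push_tensor ::
    "('a, 'n::finite) chart set \<Rightarrow> nat \<Rightarrow> ('a \<Rightarrow> 'a) \<Rightarrow> 'a \<Rightarrow> ('a, 'n) tensor \<Rightarrow> ('a, 'n) tensor" where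
  "push_tensor A p \<tau> x t =
     (\<lambda>d I. if d \<in> charts_at A (\<tau> x) \<and> length I = p
            then transform p (jac \<tau> (chart_at A x) d x) (t (chart_at A x)) I else 0)"


section \<open>Pseudo-Riemannian metrics\<close>

text \<open>\<open>r\<close> positive and \<open>s\<close> negative squares; nondegeneracy is implied.\<close>

definition has_signature :: "nat \<Rightarrow> nat \<Rightarrow> real^'n^'n \<Rightarrow> bool" where
  "has_signature r s a \<longleftrightarrow>
     (\<exists>P \<epsilon>. invertible P \<and>
        card {i. \<epsilon> i = 1} = r \<and> card {i. \<epsilon> i = -1} = s \<and> (\<forall>i::'n::finite. \<epsilon> i = 1 \<or> \<epsilon> i = -1) \<and>
        transpose P ** a ** P = (\<chi> i j. if i = j then \<epsilon> i else 0))"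

text \<open>
  A metric assigns to each point and chart at that point the matrix \<open>(g\<^sub>i\<^sub>j)\<close>.
\<close>

type_synonym ('a, 'n) metric = "'a \<Rightarrow> ('a, 'n) chart \<Rightarrow> real^'n^'n"

definition metric_on ::
    "('a, 'n::finite) chart set \<Rightarrow> nat \<Rightarrow> nat \<Rightarrow> 'a set \<Rightarrow> ('a, 'n) metric \<Rightarrow> bool" where
  "metric_on A r s U g \<longleftrightarrow>
     (\<forall>x\<in>U. \<forall>c\<in>charts_at A x. transpose (g x c) = g x c \<and> has_signature r s (g x c)) \<and>
     (\<forall>x\<in>U. \<forall>c\<in>charts_at A x. \<forall>d\<in>charts_at A x.
        g x c = transpose (jac id c d x) ** g x d ** jac id c d x) \<and>
     (\<forall>c\<in>A. smooth_on (snd c ` (U \<inter> fst c)) (\<lambda>y. g (cinv c y) c))"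

definition push_metric ::
    "('a, 'n::finite) chart set \<Rightarrow> 'a set \<Rightarrow> ('a \<Rightarrow> 'a) \<Rightarrow> ('a, 'n) metric \<Rightarrow> ('a, 'n) metric" where
  "push_metric A U \<tau> g =
     (\<lambda>y d. let \<sigma> = inv_into U \<tau>; x = \<sigma> y; c = chart_at A x; K = jac \<sigma> d c y
            in transpose K ** g x c ** K)"


section \<open>Jets of metrics\<close>

text \<open>
  The 2-jet of \<open>g\<close> at \<open>x\<close> consists of the point \<open>x\<close> and, for each chart at \<open>x\<close>, of the values at
  \<open>x\<close> of \<open>g\<^sub>i\<^sub>j\<close>, \<open>\<partial>\<^sub>k g\<^sub>i\<^sub>j\<close> and \<open>\<partial>\<^sub>k \<partial>\<^sub>l g\<^sub>i\<^sub>j\<close>. Hence two metrics have equal 2-jets at \<open>x\<close> iff they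
  agree to second order at \<open>x\<close>.
\<close>

type_synonym 'n jet_data = "(real^'n^'n) \<times> (real^'n^'n^'n) \<times> (real^'n^'n^'n^'n)"
type_synonym ('a, 'n) jet = "'a \<times> (('a, 'n) chart \<Rightarrow> 'n jet_data)"

definition jet2 :: "('a, 'n::finite) chart set \<Rightarrow> ('a, 'n) metric \<Rightarrow> 'a \<Rightarrow> ('a, 'n) jet" where
  "jet2 A g x =
     (x, \<lambda>c. if c \<in> charts_at A x
             then let h = (\<lambda>y. g (cinv c y) c); y = snd c x
                  in (h y, \<chi> k. pd k h y, \<chi> k l. pd k (pd l h) y)
             else 0)"

definition J2M ::
    "'a topology \<Rightarrow> ('a, 'n::finite) chart set \<Rightarrow> nat \<Rightarrow> nat \<Rightarrow> ('a, 'n) jet set" where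
  "J2M X A r s = {jet2 A g x | U g x. openin X U \<and> x \<in> U \<and> metric_on A r s U g}"

definition jet_coord :: "('a, 'n::finite) chart \<Rightarrow> ('a, 'n) jet \<Rightarrow> (real^'n) \<times> 'n jet_data" where
  "jet_coord c j = (snd c (fst j), snd j c)"


section \<open>Second-order natural tensors\<close>

text \<open>
  The maps \<open>jet_coord c\<close> are the fibred coordinates of \<open>J\<^sup>2M\<close>; smoothness of \<open>T\<close> is smoothness
  of its components as functions of these coordinates.
\<close>

definition second_order_tensor ::
    "'a topology \<Rightarrow> ('a, 'n::finite) chart set \<Rightarrow> nat \<Rightarrow> nat \<Rightarrow> nat \<Rightarrow>
     (('a, 'n) jet \<Rightarrow> ('a, 'n) tensor) \<Rightarrow> bool" where
  "second_order_tensor X A r s p T \<longleftrightarrow>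
     (\<forall>j\<in>J2M X A r s. T j \<in> tensors_at A p (fst j)) \<and>
     (\<forall>c\<in>A. \<forall>I. length I = p \<longrightarrow>
        (\<exists>F. smooth_on_subset (jet_coord c ` {j \<in> J2M X A r s. fst j \<in> fst c}) F \<and>
             (\<forall>j\<in>J2M X A r s. fst j \<in> fst c \<longrightarrow> T j c I = F (jet_coord c j))))"

definition natural ::
    "'a topology \<Rightarrow> ('a, 'n::finite) chart set \<Rightarrow> nat \<Rightarrow> nat \<Rightarrow> nat \<Rightarrow>
     (('a, 'n) jet \<Rightarrow> ('a, 'n) tensor) \<Rightarrow> bool" where
  "natural X A r s p T \<longleftrightarrow>
     (\<forall>U V \<tau> W g x. diffeo X A U V \<tau> \<and> openin X W \<and> metric_on A r s W g \<and> x \<in> U \<inter> W \<longrightarrow>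
        T (jet2 A (push_metric A U \<tau> g) (\<tau> x)) = push_tensor A p \<tau> x (T (jet2 A g x)))"

definition nonzero_tensor ::
    "'a topology \<Rightarrow> ('a, 'n::finite) chart set \<Rightarrow> nat \<Rightarrow> nat \<Rightarrow>
     (('a, 'n) jet \<Rightarrow> ('a, 'n) tensor) \<Rightarrow> bool" where
  "nonzero_tensor X A r s T \<longleftrightarrow> (\<exists>j\<in>J2M X A r s. T j \<noteq> (\<lambda>c I. 0))"


section \<open>Levi-Civita connection and divergence\<close>

text \<open>
  Coefficients \<open>\<Gamma> i k l\<close> (upper index first), at a point where the metric is \<open>a\<close> and its \<open>k\<close>-th
  partial derivative is \<open>b $ k\<close>, of the torsion-free connection for which the metric is parallel.
\<close>

definition levi_civita_coeffs :: "real^'n^'n \<Rightarrow> real^'n^'n^'n \<Rightarrow> ('n::finite \<Rightarrow> 'n \<Rightarrow> 'n \<Rightarrow> real) \<Rightarrow> bool" where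
  "levi_civita_coeffs a b \<Gamma> \<longleftrightarrow>
     (\<forall>i k l. \<Gamma> i k l = \<Gamma> i l k) \<and>
     (\<forall>k i j. b $ k $ i $ j - (\<Sum>m\<in>UNIV. \<Gamma> m k i * a $ m $ j) - (\<Sum>m\<in>UNIV. \<Gamma> m k j * a $ i $ m) = 0)"

definition levi_civita :: "real^'n^'n \<Rightarrow> real^'n^'n^'n \<Rightarrow> ('n::finite \<Rightarrow> 'n \<Rightarrow> 'n \<Rightarrow> real)" where
  "levi_civita a b = (THE \<Gamma>. levi_civita_coeffs a b \<Gamma>)"

lemma levi_civita_unique:
  fixes a :: "real^'n::finite^'n"
  assumes sa: "transpose a = a" and ia: "invertible a" and sb: "\<And>k. transpose (b $ k) = b $ k"
  shows "levi_civita_coeffs a b \<Gamma> \<longleftrightarrow>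
    \<Gamma> = (\<lambda>i k l. (\<Sum>m\<in>UNIV. matrix_inv a $ i $ m * (b $ k $ m $ l + b $ l $ m $ k - b $ m $ k $ l)) / 2)"
    (is "_ \<longleftrightarrow> _ = ?C")
proof -
  have a_sym: "a $ i $ j = a $ j $ i" for i j
    using arg_cong[OF sa, of "\<lambda>M. M $ i $ j"] by (simp add: transpose_def)
  have b_sym: "b $ k $ i $ j = b $ k $ j $ i" for k i j
    using arg_cong[OF sb[of k], of "\<lambda>M. M $ i $ j"] by (simp add: transpose_def)
  have inv: "a ** matrix_inv a = mat 1" "matrix_inv a ** a = mat 1"
    using ia unfolding invertible_def matrix_inv_def by (metis (mono_tags, lifting) someI_ex)+
  define low where "low G j k l = (\<Sum>m\<in>UNIV. a $ j $ m * G m k l)"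
    for G :: "'n \<Rightarrow> 'n \<Rightarrow> 'n \<Rightarrow> real" and j k l
  have raise: "G i k l = (\<Sum>m\<in>UNIV. matrix_inv a $ i $ m * low G m k l)" for G i k l
  proof -
    let ?v = "\<chi> m. G m k l"
    have "matrix_inv a *v (a *v ?v) = ?v"
      by (simp add: matrix_vector_mul_assoc inv)
    then have "(matrix_inv a *v (a *v ?v)) $ i = G i k l" by simp
    then show ?thesis by (simp add: matrix_vector_mult_def low_def)
  qed
  have lower: "low (\<lambda>i k l. \<Sum>m\<in>UNIV. matrix_inv a $ i $ m * H m k l) j k l = H j k l" for H j k l
  proof -
    let ?v = "\<chi> m. H m k l"
    have "a *v (matrix_inv a *v ?v) = ?v"
      by (simp add: matrix_vector_mul_assoc inv)
    then have "(a *v (matrix_inv a *v ?v)) $ j = H j k l" by simp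
    then show ?thesis by (simp add: matrix_vector_mult_def low_def)
  qed
  let ?H = "\<lambda>m k l. (b $ k $ m $ l + b $ l $ m $ k - b $ m $ k $ l) / 2"
  have C: "?C = (\<lambda>i k l. \<Sum>m\<in>UNIV. matrix_inv a $ i $ m * ?H m k l)"
    by (simp add: sum_divide_distrib)
  have sums: "(\<Sum>m\<in>UNIV. G m k i * a $ m $ j) = low G j k i" "(\<Sum>m\<in>UNIV. G m k j * a $ i $ m) = low G i k j"
    for G i j k
    unfolding low_def by (simp_all add: a_sym[of _ j] mult.commute)
  show ?thesis
  proof
    assume G: "levi_civita_coeffs a b \<Gamma>"
    have s: "low \<Gamma> j k l = low \<Gamma> j l k" for j k l
    proof -
      have "\<Gamma> m k l = \<Gamma> m l k" for m
        using G unfolding levi_civita_coeffs_def by blast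
      then show ?thesis by (simp add: low_def)
    qed
    have e: "b $ k $ i $ j = low \<Gamma> j k i + low \<Gamma> i k j" for i j k
    proof -
      have "b $ k $ i $ j - low \<Gamma> j k i - low \<Gamma> i k j = 0"
        using G unfolding levi_civita_coeffs_def sums by blast
      then show ?thesis by simp
    qed
    have l: "low \<Gamma> m k l = ?H m k l" for m k l
    proof -
      have "b $ k $ m $ l + b $ l $ m $ k - b $ m $ k $ l = 2 * low \<Gamma> m k l"
        unfolding e[of k m l] e[of l m k] e[of m k l] s[of l m k] s[of m l k] s[of k m l] by simp
      then show ?thesis by simp
    qed
    have "\<Gamma> i k l = (\<Sum>m\<in>UNIV. matrix_inv a $ i $ m * ?H m k l)" for i k l
      using raise[of \<Gamma> i k l] unfolding l .
    then show "\<Gamma> = ?C" unfolding C by blast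
  next
    assume G: "\<Gamma> = ?C"
    have l: "low \<Gamma> j k l = ?H j k l" for j k l
      unfolding G C by (rule lower)
    have "?C i k l = ?C i l k" for i k l
      by (simp add: b_sym[of _ k l] add.commute)
    moreover have "b $ k $ i $ j - low \<Gamma> j k i - low \<Gamma> i k j = 0" for i j k
      unfolding l using b_sym[of k i j] b_sym[of i j k] b_sym[of j k i] by (simp add: field_simps)
    ultimately show "levi_civita_coeffs a b \<Gamma>"
      unfolding levi_civita_coeffs_def sums using G by blast
  qed
qed

lemma levi_civita_eq:
  fixes a :: "real^'n::finite^'n"
  assumes "transpose a = a" and "invertible a" and "\<And>k. transpose (b $ k) = b $ k"
  shows "levi_civita a b i k l =
    (\<Sum>m\<in>UNIV. matrix_inv a $ i $ m * (b $ k $ m $ l + b $ l $ m $ k - b $ m $ k $ l)) / 2"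
  unfolding levi_civita_def levi_civita_unique[OF assms] by simp

text \<open>The Christoffel symbols of \<open>g\<close> at \<open>x\<close> in the chart \<open>c\<close>.\<close>

definition christoffel ::
    "('a, 'n::finite) metric \<Rightarrow> ('a, 'n) chart \<Rightarrow> 'a \<Rightarrow> 'n \<Rightarrow> 'n \<Rightarrow> 'n \<Rightarrow> real" where
  "christoffel g c x =
     (let h = (\<lambda>y. g (cinv c y) c); y = snd c x in levi_civita (h y) (\<chi> k. pd k h y))"

text \<open>The component \<open>\<nabla>\<^sub>k S\<^sup>I\<close> in the chart \<open>c\<close> at \<open>x\<close>, for a contravariant tensor field \<open>S\<close>.\<close>

definition nabla ::
    "('a, 'n::finite) metric \<Rightarrow> ('a \<Rightarrow> ('a, 'n) tensor) \<Rightarrow> ('a, 'n) chart \<Rightarrow> 'a \<Rightarrow> 'n \<Rightarrow> 'n list \<Rightarrow> real" where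
  "nabla g S c x k I =
     pd k (\<lambda>y. S (cinv c y) c I) (snd c x) +
     (\<Sum>a<length I. \<Sum>m\<in>UNIV. christoffel g c x (I ! a) k m * S x c (I[a := m]))"

definition field_of ::
    "('a, 'n::finite) chart set \<Rightarrow> (('a, 'n) jet \<Rightarrow> ('a, 'n) tensor) \<Rightarrow> ('a, 'n) metric \<Rightarrow> 'a \<Rightarrow> ('a, 'n) tensor" where
  "field_of A T g x = T (jet2 A g x)"

definition divergence ::
    "('a, 'n::finite) chart set \<Rightarrow> nat \<Rightarrow> (('a, 'n) jet \<Rightarrow> ('a, 'n) tensor) \<Rightarrow> ('a, 'n) metric \<Rightarrow> 'a \<Rightarrow> ('a, 'n) tensor" where
  "divergence A p T g x =
     (\<lambda>c J. if c \<in> charts_at A x \<and> length J = p - 1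
            then \<Sum>k\<in>UNIV. nabla g (field_of A T g) c x k (J @ [k]) else 0)"

definition divergence_free ::
    "'a topology \<Rightarrow> ('a, 'n::finite) chart set \<Rightarrow> nat \<Rightarrow> nat \<Rightarrow> nat \<Rightarrow>
     (('a, 'n) jet \<Rightarrow> ('a, 'n) tensor) \<Rightarrow> bool" where
  "divergence_free X A r s p T \<longleftrightarrow>
     (\<forall>U g. openin X U \<and> metric_on A r s U g \<longrightarrow> (\<forall>x\<in>U. divergence A p T g x = (\<lambda>c J. 0)))"

end

(*
  Naturality alone kills tensors of odd degree. Near a point x write psi u = (u - a) + Gamma(u - a, u - a)/2
  in a chart centred at x, with Gamma the Christoffel symbols of g at x. In the coordinates psi the first
  derivatives of g vanish at x, so the involution psi^-1 o (-id) o psi fixes x, has Jacobian -1 there, and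
  preserves the 2-jet of g at x. Naturality for this involution reads T = (-1)^p T.
*)

theory Submission
  imports Defs
begin

text \<open>Parity explains why a quadratic polynomial is enough: under v -> -v the value and the
  second derivatives at the origin are unchanged, so only the first derivatives obstruct symmetry of
  the 2-jet. \<open>\<psi>\<close> is the Taylor polynomial of degree two of normal coordinates,
  whence the factor 1/2; higher terms would change the second derivatives but not their parity, so
  no geodesics have to be constructed.

  The obstacle is that a jet records derivatives in every chart at x, whereas the symmetry is built
  in one. Explicit second-order chain rules are avoided by the predicate \<open>flat m\<close> (zero
  m-jet), which is stable under multiplication by smooth factors and under composition, hence under
  pull-back of matrices. One parity argument at the origin of the \<open>\<psi>\<close> coordinates
  is thereby carried to the given chart and from there to all charts.

  Naturality also demands an honest diffeomorphism between open sets. This forces a domain mapped to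
  itself, taken as the preimage of a ball, and smoothness of the inverse of \<open>\<psi>\<close> to
  all orders.\<close>

subsection \<open>Calculus of \<open>C\<^sup>k\<close> maps\<close>

lemma Ck_on_subset: "Ck_on k S f \<Longrightarrow> T \<subseteq> S \<Longrightarrow> Ck_on k T f"
  by (induction k arbitrary: f) (auto intro: continuous_on_subset)

text \<open>Both sides are Hilbert choices from the same predicate, because having the derivative
  \<open>D\<close> at \<open>x\<close> depends only on the germ. Hence the equality holds even where
  the maps are not differentiable.\<close>

lemma frechet_derivative_cong_open:
  assumes "open S" "x \<in> S" "\<And>y. y \<in> S \<Longrightarrow> f y = g y"
  shows "frechet_derivative f (at x) = frechet_derivative g (at x)"
proof -
  have "(f has_derivative D) (at x) \<longleftrightarrow> (g has_derivative D) (at x)" for D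
    using assms by (metis has_derivative_transform_within_open)
  then show ?thesis unfolding frechet_derivative_def by simp
qed

lemma differentiable_cong_open:
  assumes "open S" "x \<in> S" "\<And>y. y \<in> S \<Longrightarrow> f y = g y"
  shows "f differentiable (at x) \<longleftrightarrow> g differentiable (at x)"
  using assms unfolding differentiable_def by (metis has_derivative_transform_within_open)

lemma Ck_on_cong:
  assumes "open S" "\<And>y. y \<in> S \<Longrightarrow> f y = g y"
  shows "Ck_on k S f \<longleftrightarrow> Ck_on k S g"
  using assms(2)
proof (induction k arbitrary: f g)
  case 0
  then show ?case by (simp cong: continuous_on_cong)
next
  case (Suc k)
  have "Ck_on k S (\<lambda>x. frechet_derivative f (at x) v) \<longleftrightarrow>
        Ck_on k S (\<lambda>x. frechet_derivative g (at x) v)" for v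
    by (rule Suc.IH) (simp add: frechet_derivative_cong_open[OF assms(1) _ Suc.prems])
  then show ?case
    using differentiable_cong_open[OF assms(1) _ Suc.prems] by simp
qed

text \<open>The induction step shared by the closure lemmas below: a differentiation rule supplies
  \<open>D\<close>, and \<open>D x v\<close> for fixed \<open>v\<close> is again built from maps
  already known to be C^k.\<close>

lemma Ck_on_SucI:
  assumes "open S" "\<And>x. x \<in> S \<Longrightarrow> (f has_derivative D x) (at x)"
    and "\<And>v. Ck_on k S (\<lambda>x. D x v)"
  shows "Ck_on (Suc k) S f"
proof -
  have "Ck_on k S (\<lambda>x. frechet_derivative f (at x) v)" for v
    using assms(3)[of v]
    by (subst Ck_on_cong[OF assms(1), of _ "\<lambda>x. D x v"])
      (simp_all add: frechet_derivative_at[OF assms(2), symmetric])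
  then show ?thesis using assms(2) by (auto simp: differentiable_def)
qed

lemma Ck_on_Suc_has_derivative:
  "Ck_on (Suc k) S f \<Longrightarrow> x \<in> S \<Longrightarrow> (f has_derivative frechet_derivative f (at x)) (at x)"
  by (simp add: frechet_derivative_works)

lemma Ck_on_SucD: "Ck_on (Suc k) S f \<Longrightarrow> Ck_on k S f"
proof (induction k arbitrary: f)
  case 0
  then show ?case
    by (auto intro!: differentiable_imp_continuous_on
        simp: differentiable_on_def differentiable_at_withinI)
next
  case (Suc k)
  from Suc.prems have "Ck_on (Suc k) S (\<lambda>x. frechet_derivative f (at x) v)" for v by simp
  with Suc.prems Suc.IH show ?case by simp
qed

lemma Ck_on_const: "Ck_on k S (\<lambda>x. c)"
  by (induction k arbitrary: c) simp_all

lemma Ck_on_add: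
  assumes "open S" "Ck_on k S f" "Ck_on k S g"
  shows "Ck_on k S (\<lambda>x. f x + g x)"
  using assms(2,3)
proof (induction k arbitrary: f g)
  case 0
  then show ?case by (simp add: continuous_on_add)
next
  case (Suc k)
  show ?case
  proof (rule Ck_on_SucI[OF assms(1)])
    show "((\<lambda>x. f x + g x) has_derivative
        (\<lambda>v. frechet_derivative f (at x) v + frechet_derivative g (at x) v)) (at x)" if "x \<in> S" for x
      using Suc.prems[THEN Ck_on_Suc_has_derivative] that by (intro has_derivative_add) auto
  qed (use Suc in simp)
qed

lemma Ck_on_sum:
  assumes "open S" "\<And>i. i \<in> I \<Longrightarrow> Ck_on k S (f i)"
  shows "Ck_on k S (\<lambda>x. \<Sum>i\<in>I. f i x)"
  using assms(2) by (induction I rule: infinite_finite_induct) (simp_all add: Ck_on_const Ck_on_add assms(1))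

text \<open>The product rule gives two terms of the same bilinear shape, so the induction closes.
  One statement serves real, scalar and matrix products, and linear maps by fixing the scalar
  1.\<close>

lemma Ck_on_bilinear:
  assumes B: "bounded_bilinear B" and S: "open S" and "Ck_on k S f" "Ck_on k S g"
  shows "Ck_on k S (\<lambda>x. B (f x) (g x))"
  using assms(3,4)
proof (induction k arbitrary: f g)
  case 0
  then show ?case using bounded_bilinear.continuous_on[OF B] by auto
next
  case (Suc k)
  show ?case
  proof (rule Ck_on_SucI[OF S])
    show "((\<lambda>x. B (f x) (g x)) has_derivative (\<lambda>v. B (f x) (frechet_derivative g (at x) v) +
        B (frechet_derivative f (at x) v) (g x))) (at x)" if "x \<in> S" for x
      using Suc.prems[THEN Ck_on_Suc_has_derivative] that by (intro bounded_bilinear.FDERIV[OF B]) auto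
    show "Ck_on k S (\<lambda>x. B (f x) (frechet_derivative g (at x) v) +
        B (frechet_derivative f (at x) v) (g x))" for v
      using Suc.prems Ck_on_SucD[OF Suc.prems(1)] Ck_on_SucD[OF Suc.prems(2)]
      by (intro Ck_on_add S Suc.IH) auto
  qed
qed

lemma Ck_on_linear:
  assumes "bounded_linear L" "open S" "Ck_on k S f"
  shows "Ck_on k S (\<lambda>x. L (f x))"
proof -
  have "bounded_bilinear (\<lambda>(a::real) x. a *\<^sub>R L x)"
    using bounded_bilinear.comp[OF bounded_bilinear_scaleR bounded_linear_ident assms(1)] by simp
  from Ck_on_bilinear[OF this assms(2) Ck_on_const assms(3), of 1] show ?thesis by simp
qed

lemma Ck_on_ident:
  assumes "open S" shows "Ck_on k S (\<lambda>x. x)"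
proof (cases k)
  case (Suc m)
  show ?thesis unfolding Suc
    by (rule Ck_on_SucI[OF assms has_derivative_ident Ck_on_const])
qed simp

lemma linear_Basis_expansion:
  fixes D :: "'e::euclidean_space \<Rightarrow> 'f::real_normed_vector"
  assumes "linear D"
  shows "D v = (\<Sum>b\<in>Basis. (v \<bullet> b) *\<^sub>R D b)"
proof -
  have "D v = D (\<Sum>b\<in>Basis. (v \<bullet> b) *\<^sub>R b)" by (simp add: euclidean_representation)
  also have "\<dots> = (\<Sum>b\<in>Basis. (v \<bullet> b) *\<^sub>R D b)"
    by (simp add: linear_sum[OF assms] linear_scale[OF assms])
  finally show ?thesis .
qed

text \<open>In the chain rule the derivative of \<open>f\<close> is applied to a direction that
  moves with \<open>x\<close>, whereas \<open>Ck_on\<close> tests fixed directions. Expanding the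
  moving direction in \<open>Basis\<close> leaves scalar coefficients times derivatives of
  \<open>f\<close> in fixed directions, to which the induction hypothesis applies.\<close>

lemma Ck_on_compose:
  fixes f :: "'e::euclidean_space \<Rightarrow> 'f::real_normed_vector"
  assumes "open S" "open T" "\<phi> ` S \<subseteq> T" "Ck_on k T f" "Ck_on k S \<phi>"
  shows "Ck_on k S (\<lambda>x. f (\<phi> x))"
  using assms(4,5)
proof (induction k arbitrary: f)
  case 0
  then show ?case using assms(3) by (auto intro: continuous_on_compose2)
next
  case (Suc k)
  show ?case
  proof (rule Ck_on_SucI[OF assms(1)])
    show "((\<lambda>x. f (\<phi> x)) has_derivative (\<lambda>v. \<Sum>b\<in>Basis.
        (frechet_derivative \<phi> (at x) v \<bullet> b) *\<^sub>R frechet_derivative f (at (\<phi> x)) b)) (at x)"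
      if x: "x \<in> S" for x
    proof -
      have f: "(f has_derivative frechet_derivative f (at (\<phi> x))) (at (\<phi> x))"
        using Ck_on_Suc_has_derivative[OF Suc.prems(1)] x assms(3) by auto
      show ?thesis
        unfolding linear_Basis_expansion[OF has_derivative_linear[OF f], symmetric]
        by (rule has_derivative_compose[OF Ck_on_Suc_has_derivative[OF Suc.prems(2) x] f])
    qed
    show "Ck_on k S (\<lambda>x. \<Sum>b\<in>Basis.
        (frechet_derivative \<phi> (at x) v \<bullet> b) *\<^sub>R frechet_derivative f (at (\<phi> x)) b)" for v
    proof (intro Ck_on_sum Ck_on_bilinear[OF bounded_bilinear_scaleR] assms(1))
      fix b :: 'e
      show "Ck_on k S (\<lambda>x. frechet_derivative \<phi> (at x) v \<bullet> b)"
        using Suc.prems by (intro Ck_on_linear[OF bounded_linear_inner_left assms(1)]) simp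
      show "Ck_on k S (\<lambda>x. frechet_derivative f (at (\<phi> x)) b)"
        by (rule Suc.IH) (use Suc.prems Ck_on_SucD[OF Suc.prems(2)] in auto)
    qed
  qed
qed

lemma Ck_on_inverse:
  fixes f :: "'e::real_normed_vector \<Rightarrow> real"
  assumes "open S" "\<And>x. x \<in> S \<Longrightarrow> f x \<noteq> 0" "Ck_on k S f"
  shows "Ck_on k S (\<lambda>x. inverse (f x))"
  using assms(3)
proof (induction k)
  case 0
  then show ?case using assms(2) by (simp add: continuous_on_inverse)
next
  case (Suc k)
  have i: "Ck_on k S (\<lambda>x. inverse (f x))" using Suc by (metis Ck_on_SucD)
  show ?case
  proof (rule Ck_on_SucI[OF assms(1)])
    show "((\<lambda>x. inverse (f x)) has_derivative
        (\<lambda>v. - (inverse (f x) * frechet_derivative f (at x) v * inverse (f x)))) (at x)" if "x \<in> S" for x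
      by (intro Deriv.has_derivative_inverse assms(2) that Ck_on_Suc_has_derivative[OF Suc.prems])
    show "Ck_on k S (\<lambda>x. - (inverse (f x) * frechet_derivative f (at x) v * inverse (f x)))" for v
      by (intro Ck_on_linear[OF bounded_linear_minus[OF bounded_linear_ident]] 
          Ck_on_bilinear[OF bounded_bilinear_mult] i assms(1)) (use Suc.prems in simp)
  qed
qed

lemma Ck_on_prod:
  fixes f :: "'i \<Rightarrow> 'e::real_normed_vector \<Rightarrow> real"
  assumes "open S" "\<And>i. i \<in> I \<Longrightarrow> Ck_on k S (f i)"
  shows "Ck_on k S (\<lambda>x. \<Prod>i\<in>I. f i x)"
  using assms(2)
  by (induction I rule: infinite_finite_induct)
    (simp_all add: Ck_on_const Ck_on_bilinear[OF bounded_bilinear_mult assms(1)])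

lemma Ck_on_componentwise:
  fixes f :: "'e::real_normed_vector \<Rightarrow> 'f::euclidean_space"
  assumes "open S" "\<And>b. b \<in> Basis \<Longrightarrow> Ck_on k S (\<lambda>x. f x \<bullet> b)"
  shows "Ck_on k S f"
proof -
  have "Ck_on k S (\<lambda>x. \<Sum>b\<in>Basis. (f x \<bullet> b) *\<^sub>R b)"
    by (intro Ck_on_sum Ck_on_linear[OF bounded_linear_scaleR_left] assms)
  then show ?thesis by (simp add: euclidean_representation)
qed

lemma Ck_on_vec_nth:
  fixes f :: "'e::real_normed_vector \<Rightarrow> ('f::real_normed_vector)^'n"
  shows "open S \<Longrightarrow> Ck_on k S f \<Longrightarrow> Ck_on k S (\<lambda>x. f x $ i)"
  by (intro Ck_on_linear[OF bounded_linear_vec_nth])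

lemma Ck_on_vec_lambda:
  fixes f :: "'n::finite \<Rightarrow> 'e::real_normed_vector \<Rightarrow> 'f::euclidean_space"
  assumes "open S" "\<And>i. Ck_on k S (f i)"
  shows "Ck_on k S (\<lambda>x. \<chi> i. f i x)"
proof (rule Ck_on_componentwise[OF assms(1)])
  fix b :: "'f^'n" assume "b \<in> Basis"
  then obtain i u where "b = axis i u" by (auto simp: Basis_vec_def)
  then show "Ck_on k S (\<lambda>x. (\<chi> i. f i x) \<bullet> b)"
    using Ck_on_linear[OF bounded_linear_inner_left assms] by (simp add: inner_axis)
qed

lemma Ck_on_det:
  fixes M :: "'e::real_normed_vector \<Rightarrow> real^'n^'n"
  assumes "open S" "\<And>i j. Ck_on k S (\<lambda>x. M x $ i $ j)"
  shows "Ck_on k S (\<lambda>x. det (M x))"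
  unfolding det_def
  by (intro Ck_on_sum Ck_on_bilinear[OF bounded_bilinear_mult] Ck_on_const Ck_on_prod assms)

subsection \<open>Vanishing to finite order\<close>

text \<open>For smooth maps this says that the m-jet at \<open>a\<close> is zero, so two metrics
  have equal 2-jets when their difference is \<open>flat 2\<close>. The recursion follows that of
  \<open>Ck_on\<close>, so both are handled by the same inductions.\<close>

primrec flat :: "nat \<Rightarrow> (real^'n::finite \<Rightarrow> 'f::real_normed_vector) \<Rightarrow> real^'n \<Rightarrow> bool" where
  "flat 0 f a \<longleftrightarrow> f a = 0"
| "flat (Suc m) f a \<longleftrightarrow> f a = 0 \<and> (\<forall>k. flat m (pd k f) a)"

lemma pd_eq: "(f has_derivative D) (at x) \<Longrightarrow> pd k f x = D (axis k 1)"
  unfolding pd_def by (simp add: frechet_derivative_at[symmetric])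

lemma pd_cong_open:
  assumes "open S" "x \<in> S" "\<And>y. y \<in> S \<Longrightarrow> f y = g y"
  shows "pd k f x = pd k g x"
  unfolding pd_def by (simp add: frechet_derivative_cong_open[OF assms])

lemma Ck_on_pd: "Ck_on (Suc m) S f \<Longrightarrow> Ck_on m S (pd k f)"
  by (simp add: pd_def[abs_def])

lemma flat_cong:
  assumes "open S" "a \<in> S" "\<And>y. y \<in> S \<Longrightarrow> f y = g y"
  shows "flat m f a \<longleftrightarrow> flat m g a"
  using assms(3)
proof (induction m arbitrary: f g)
  case 0
  then show ?case using assms(2) by simp
next
  case (Suc m)
  have "flat m (pd k f) a \<longleftrightarrow> flat m (pd k g) a" for k
    by (rule Suc.IH) (rule pd_cong_open[OF assms(1) _ Suc.prems])
  then show ?case using Suc.prems[OF assms(2)] by simp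
qed

lemma flat_SucD: "flat (Suc m) f a \<Longrightarrow> flat m f a"
  by (induction m arbitrary: f) auto

lemma flat_zero: "flat m (\<lambda>x. 0) a"
proof (induction m)
  case (Suc m)
  then show ?case by (simp add: pd_def[abs_def])
qed simp

lemma flat_add:
  assumes "open S" "a \<in> S" "Ck_on m S f" "Ck_on m S g" "flat m f a" "flat m g a"
  shows "flat m (\<lambda>x. f x + g x) a"
  using assms(3-)
proof (induction m arbitrary: f g)
  case (Suc m)
  have "flat m (pd k (\<lambda>x. f x + g x)) a" for k
  proof (subst flat_cong[OF assms(1,2)])
    show "pd k (\<lambda>x. f x + g x) y = pd k f y + pd k g y" if "y \<in> S" for y
      unfolding pd_def[of k f] pd_def[of k g]
      by (intro pd_eq has_derivative_add Ck_on_Suc_has_derivative[OF Suc.prems(1) that]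
        Ck_on_Suc_has_derivative[OF Suc.prems(2) that])
    show "flat m (\<lambda>y. pd k f y + pd k g y) a"
      using Suc.prems by (intro Suc.IH Ck_on_pd) auto
  qed
  then show ?case using Suc.prems by simp
qed simp

lemma flat_sum:
  assumes "open S" "a \<in> S" "\<And>i. i \<in> I \<Longrightarrow> Ck_on m S (f i)" "\<And>i. i \<in> I \<Longrightarrow> flat m (f i) a"
  shows "flat m (\<lambda>x. \<Sum>i\<in>I. f i x) a"
  using assms(3,4)
proof (induction I rule: infinite_finite_induct)
  case (insert i I)
  then have "flat m (\<lambda>x. f i x + (\<Sum>i\<in>I. f i x)) a"
    by (intro flat_add[OF assms(1,2)] Ck_on_sum[OF assms(1)]) auto
  with insert.hyps show ?case by simp
qed (simp_all add: flat_zero)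

text \<open>The ideal property of maps with zero m-jet: of the two terms of the product rule, one
  contains \<open>f\<close> and the other \<open>pd k f\<close>, and both of these are flat of the
  order required.\<close>

lemma flat_bilinear:
  assumes B: "bounded_bilinear B" and "open S" "a \<in> S" "Ck_on m S f" "Ck_on m S g" "flat m f a"
  shows "flat m (\<lambda>x. B (f x) (g x)) a"
  using assms(4-)
proof (induction m arbitrary: f g)
  case 0
  then show ?case by (simp add: bounded_bilinear.zero_left[OF B])
next
  case (Suc m)
  note C = Ck_on_SucD[OF Suc.prems(1)] Ck_on_SucD[OF Suc.prems(2)]
  have "flat m (pd k (\<lambda>x. B (f x) (g x))) a" for k
  proof (subst flat_cong[OF assms(2,3)])
    show "pd k (\<lambda>x. B (f x) (g x)) y = B (f y) (pd k g y) + B (pd k f y) (g y)" if "y \<in> S" for y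
      unfolding pd_def[of k f] pd_def[of k g]
      by (intro pd_eq bounded_bilinear.FDERIV[OF B] Ck_on_Suc_has_derivative[OF Suc.prems(1) that]
        Ck_on_Suc_has_derivative[OF Suc.prems(2) that])
    show "flat m (\<lambda>y. B (f y) (pd k g y) + B (pd k f y) (g y)) a"
      using Suc.prems(3) flat_SucD[OF Suc.prems(3)]
      by (intro flat_add[OF assms(2,3)] Ck_on_bilinear[OF B assms(2)] Suc.IH Ck_on_pd C Suc.prems) auto
  qed
  moreover have "B (f a) (g a) = 0" 
    using Suc.prems by (simp add: bounded_bilinear.zero_left[OF B])
  ultimately show ?case by simp
qed

lemma linear_axis_expansion:
  fixes D :: "real^'n \<Rightarrow> 'f::real_normed_vector"
  assumes "linear D"
  shows "D v = (\<Sum>k\<in>UNIV. v $ k *\<^sub>R D (axis k 1))"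
proof -
  have "D v = D (\<Sum>k\<in>UNIV. v $ k *\<^sub>R axis k 1)" using basis_expansion[of v] by (simp add: scalar_mult_eq_scaleR)
  also have "\<dots> = (\<Sum>k\<in>UNIV. v $ k *\<^sub>R D (axis k 1))"
    by (simp add: linear_sum[OF assms] linear_scale[OF assms])
  finally show ?thesis .
qed

text \<open>By the chain rule each partial derivative is a combination of the maps
  \<open>pd l f\<close> composed with \<open>\<phi>\<close>, which are flat of one order less; the
  coefficients coming from \<open>\<phi>\<close> are absorbed by the ideal property.\<close>

lemma flat_compose:
  fixes f :: "real^'m \<Rightarrow> 'f::real_normed_vector" and \<phi> :: "real^'n \<Rightarrow> real^'m"
  assumes "open S" "open T" "\<phi> ` S \<subseteq> T" "b \<in> S"
    and "Ck_on m T f" "Ck_on m S \<phi>" "flat m f (\<phi> b)"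
  shows "flat m (\<lambda>x. f (\<phi> x)) b"
  using assms(5-)
proof (induction m arbitrary: f)
  case (Suc m)
  have "flat m (pd k (\<lambda>x. f (\<phi> x))) b" for k
  proof (subst flat_cong[OF assms(1,4)])
    show "pd k (\<lambda>x. f (\<phi> x)) y = (\<Sum>l\<in>UNIV. pd k \<phi> y $ l *\<^sub>R pd l f (\<phi> y))" if y: "y \<in> S" for y
    proof -
      have f: "(f has_derivative frechet_derivative f (at (\<phi> y))) (at (\<phi> y))"
        using Ck_on_Suc_has_derivative[OF Suc.prems(1)] y assms(3) by auto
      show ?thesis
        unfolding pd_def[of k \<phi>] pd_def[of _ f] linear_axis_expansion[OF has_derivative_linear[OF f], symmetric]
        by (rule pd_eq[OF has_derivative_compose[OF Ck_on_Suc_has_derivative[OF Suc.prems(2) y] f]])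
    qed
    show "flat m (\<lambda>y. \<Sum>l\<in>UNIV. pd k \<phi> y $ l *\<^sub>R pd l f (\<phi> y)) b"
    proof (intro flat_sum[OF assms(1,4)])
      fix l
      note C = Ck_on_vec_nth[OF assms(1) Ck_on_pd[OF Suc.prems(2)], of k l]
        Ck_on_compose[OF assms(1-3) Ck_on_pd[OF Suc.prems(1)] Ck_on_SucD[OF Suc.prems(2)], of l]
      show "Ck_on m S (\<lambda>y. pd k \<phi> y $ l *\<^sub>R pd l f (\<phi> y))"
        by (rule Ck_on_bilinear[OF bounded_bilinear_scaleR assms(1) C])
      have "flat m (\<lambda>y. pd l f (\<phi> y)) b"
        by (rule Suc.IH) (use Suc.prems Ck_on_SucD[OF Suc.prems(2)] Ck_on_pd in auto)
      then show "flat m (\<lambda>y. pd k \<phi> y $ l *\<^sub>R pd l f (\<phi> y)) b"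
        by (rule flat_bilinear[OF bounded_bilinear.flip[OF bounded_bilinear_scaleR] assms(1,4) C(2,1)])
    qed
  qed
  then show ?case using Suc.prems by simp
qed simp

subsection \<open>Pull-back of matrix-valued maps\<close>

definition jmat :: "(real^'n::finite \<Rightarrow> real^'n) \<Rightarrow> real^'n \<Rightarrow> real^'n^'n" where
  "jmat F y = matrix (frechet_derivative F (at y))"

text \<open>The coordinate form of F^*h for a covariant 2-tensor. Both the chart-change law in
  \<open>metric_on\<close> and the formula in \<open>push_metric\<close> have this shape, the latter
  for the inverse map.\<close>

definition pullback :: "(real^'n::finite \<Rightarrow> real^'n) \<Rightarrow> (real^'n \<Rightarrow> real^'n^'n) \<Rightarrow> real^'n \<Rightarrow> real^'n^'n" where
  "pullback F h y = transpose (jmat F y) ** h (F y) ** jmat F y"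

lemma bounded_bilinear_matrix_mult:
  "bounded_bilinear ((**) :: real^'n^'m \<Rightarrow> real^'k^'n \<Rightarrow> real^'k^'m)"
  unfolding bilinear_conv_bounded_bilinear[symmetric] bilinear_def
  by (intro conjI allI linearI)
    (simp_all add: matrix_matrix_mult_def vec_eq_iff algebra_simps sum.distrib sum_distrib_left)

lemma bounded_linear_transpose: "bounded_linear (transpose :: real^'n^'m \<Rightarrow> real^'m^'n)"
  unfolding linear_conv_bounded_linear[symmetric]
  by (intro linearI) (simp_all add: transpose_def vec_eq_iff)

lemma jmat_eq: "(F has_derivative D) (at y) \<Longrightarrow> jmat F y = matrix D"
  unfolding jmat_def by (simp add: frechet_derivative_at[symmetric])

lemma jmat_cong_open:
  assumes "open S" "x \<in> S" "\<And>y. y \<in> S \<Longrightarrow> f y = g y"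
  shows "jmat f x = jmat g x"
  unfolding jmat_def by (simp add: frechet_derivative_cong_open[OF assms])

lemma jmat_compose:
  assumes "F differentiable (at y)" "G differentiable (at (F y))"
  shows "jmat (\<lambda>x. G (F x)) y = jmat G (F y) ** jmat F y"
  using frechet_derivative_compose[OF assms] assms
  by (simp add: jmat_def o_def[of G F] matrix_compose linear_frechet_derivative)

lemma Ck_on_jmat:
  assumes "open S" "Ck_on (Suc m) S F"
  shows "Ck_on m S (jmat F)"
  using assms unfolding jmat_def[abs_def] matrix_def
  by (intro Ck_on_vec_lambda Ck_on_vec_nth) auto

lemma pullback_compose:
  assumes "F differentiable (at y)" "G differentiable (at (F y))"
  shows "pullback F (pullback G h) y = pullback (\<lambda>x. G (F x)) h y"
  unfolding pullback_def jmat_compose[OF assms] matrix_transpose_mul by (simp add: matrix_mul_assoc)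

lemma pullback_cong_open:
  assumes "open S" "x \<in> S" "\<And>y. y \<in> S \<Longrightarrow> f y = g y"
  shows "pullback f h x = pullback g h x"
  unfolding pullback_def by (simp add: jmat_cong_open[OF assms] assms)

lemma jmat_ident: "jmat (\<lambda>x. x) y = mat 1"
  by (simp add: jmat_def matrix_id_mat_1 [unfolded id_def])

lemma pullback_ident: "pullback (\<lambda>x. x) h y = h y"
  by (simp add: pullback_def jmat_ident)

lemma pullback_diff: "pullback F (\<lambda>x. f x - g x) y = pullback F f y - pullback F g y"
  unfolding pullback_def bounded_bilinear.diff_right[OF bounded_bilinear_matrix_mult]
    bounded_bilinear.diff_left[OF bounded_bilinear_matrix_mult] ..

lemma Ck_on_pullback:
  assumes "open S" "open T" "F ` S \<subseteq> T" "Ck_on (Suc m) S F" "Ck_on m T h"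
  shows "Ck_on m S (pullback F h)"
proof -
  note J = Ck_on_jmat[OF assms(1,4)]
  note C = Ck_on_bilinear[OF bounded_bilinear_matrix_mult assms(1)]
  show ?thesis unfolding pullback_def[abs_def]
    by (rule C[OF C[OF Ck_on_linear[OF bounded_linear_transpose assms(1) J]
          Ck_on_compose[OF assms(1-3,5) Ck_on_SucD[OF assms(4)]]] J])
qed

text \<open>Composition keeps flatness and the two Jacobian factors are absorbed by the ideal
  property. This makes the comparison of 2-jets independent of coordinates.\<close>

lemma flat_pullback:
  assumes "open S" "open T" "F ` S \<subseteq> T" "b \<in> S" "Ck_on (Suc m) S F" "Ck_on m T h" "flat m h (F b)"
  shows "flat m (pullback F h) b"
proof -
  note C = Ck_on_jmat[OF assms(1,5)] Ck_on_linear[OF bounded_linear_transpose assms(1) Ck_on_jmat[OF assms(1,5)]]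
    Ck_on_compose[OF assms(1-3,6) Ck_on_SucD[OF assms(5)]]
  have "flat m (\<lambda>y. h (F y)) b"
    using Ck_on_SucD[OF assms(5)] assms by (intro flat_compose[OF assms(1-4)])
  then have "flat m (\<lambda>y. transpose (jmat F y) ** h (F y)) b"
    by (rule flat_bilinear[OF bounded_bilinear.flip[OF bounded_bilinear_matrix_mult] assms(1,4) C(3,2)])
  then show ?thesis unfolding pullback_def[abs_def]
    by (rule flat_bilinear[OF bounded_bilinear_matrix_mult assms(1,4)
          Ck_on_bilinear[OF bounded_bilinear_matrix_mult assms(1) C(2,3)] C(1)])
qed

subsection \<open>Geodesic symmetry to second order\<close>

lemma matrix_inv_mult:
  fixes A :: "real^'n^'n"
  assumes "invertible A"
  shows "A ** matrix_inv A = mat 1" "matrix_inv A ** A = mat 1"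
  using assms unfolding invertible_def matrix_inv_def by (metis (mono_tags, lifting) someI_ex)+

text \<open>Cramer's rule writes every component as a quotient of determinants, that is, of
  polynomials in the entries of \<open>M x\<close> and \<open>v\<close>.\<close>

lemma Ck_on_matrix_inv_mult:
  fixes M :: "'e::real_normed_vector \<Rightarrow> real^'n^'n"
  assumes "open S" "Ck_on k S M" "\<And>x. x \<in> S \<Longrightarrow> invertible (M x)"
  shows "Ck_on k S (\<lambda>x. matrix_inv (M x) *v v)"
proof -
  let ?X = "\<lambda>x. \<chi> l. det (\<chi> i j. if j = l then v $ i else M x $ i $ j) * inverse (det (M x))"
  have entry: "Ck_on k S (\<lambda>x. M x $ i $ j)" for i j
    by (intro Ck_on_vec_nth assms)
  have nz: "det (M x) \<noteq> 0" if "x \<in> S" for x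
    using assms(3)[OF that] by (simp add: invertible_det_nz)
  have "Ck_on k S (\<lambda>x. (\<chi> i j. if j = l then v $ i else M x $ i $ j) $ i $ j)" for l i j
    by (cases "j = l") (simp_all add: Ck_on_const entry)
  then have "Ck_on k S ?X"
    by (intro Ck_on_vec_lambda Ck_on_bilinear[OF bounded_bilinear_mult] Ck_on_det
        Ck_on_inverse nz entry assms(1))
  moreover have "matrix_inv (M x) *v v = ?X x" if "x \<in> S" for x
  proof -
    have "M x *v (matrix_inv (M x) *v v) = v"
      using assms(3)[OF that] by (simp add: matrix_vector_mul_assoc matrix_inv_mult)
    then show ?thesis unfolding cramer[OF nz[OF that]] by (simp add: divide_inverse)
  qed
  ultimately show ?thesis
    using Ck_on_cong[OF assms(1), of "\<lambda>x. matrix_inv (M x) *v v" ?X] by simp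
qed

text \<open>Bootstrapping: if \<open>g\<close> is C^k, then so is \<open>D\<close> composed with
  \<open>g\<close>, hence also its inverse matrix, which is the derivative of \<open>g\<close>; so
  \<open>g\<close> is C^(k+1).\<close>

lemma Ck_on_inverse_function:
  fixes g :: "real^'n \<Rightarrow> real^'n"
  assumes "open W" "open U" "g ` W \<subseteq> U" and D: "\<And>k. Ck_on k U D"
    and inv: "\<And>y. y \<in> W \<Longrightarrow> invertible (D (g y))"
    and g': "\<And>y. y \<in> W \<Longrightarrow> (g has_derivative (\<lambda>v. matrix_inv (D (g y)) *v v)) (at y)"
  shows "Ck_on k W g"
proof (induction k)
  case 0
  show ?case
    using g' by (auto intro!: continuous_at_imp_continuous_on has_derivative_continuous)
next
  case (Suc k)
  show ?case
    by (rule Ck_on_SucI[OF assms(1) g' Ck_on_matrix_inv_mult[OF assms(1)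
            Ck_on_compose[OF assms(1-3) D Suc] inv]])
qed

lemma has_derivative_reflect:
  fixes f :: "'e::real_normed_vector \<Rightarrow> 'f::real_normed_vector"
  assumes "(f has_derivative D) (at (- v))"
  shows "((\<lambda>v. f (- v)) has_derivative (\<lambda>u. - D u)) (at v)"
  using has_derivative_compose[OF has_derivative_minus[OF has_derivative_ident] assms]
    linear_neg[OF has_derivative_linear[OF assms]] by simp

text \<open>The map is odd, so its value and its second derivatives at 0 vanish by symmetry. Its
  first derivatives are the only condition left, and they vanish by the assumption on
  \<open>k\<close>.\<close>

lemma flat_odd_part:
  assumes "open W" "0 \<in> W" "\<And>v. v \<in> W \<Longrightarrow> - v \<in> W" "Ck_on 2 W k" "\<And>i. pd i k 0 = 0"
  shows "flat 2 (\<lambda>v. k (- v) - k v) 0"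
proof -
  have C: "Ck_on (Suc (Suc 0)) W k" using assms(4) by (simp add: numeral_2_eq_2)
  have 1: "pd i (\<lambda>v. k (- v) - k v) v = - pd i k (- v) - pd i k v" if "v \<in> W" for i v
    unfolding pd_def[of i k]
    by (rule pd_eq[OF has_derivative_diff[OF
            has_derivative_reflect[OF Ck_on_Suc_has_derivative[OF C assms(3)[OF that]]]
            Ck_on_Suc_has_derivative[OF C that]]])
  \<comment> \<open>For q = \<open>pd i k\<close>, the map q(-v) + q(v) is even, so its derivative
    at 0 is zero.\<close>
  have 2: "pd j (\<lambda>v. - pd i k (- v) - pd i k v) 0 = 0" for i j
  proof -
    let ?q = "pd i k"
    have d: "(?q has_derivative frechet_derivative ?q (at 0)) (at 0)"
      by (rule Ck_on_Suc_has_derivative[OF Ck_on_pd[OF C] assms(2)])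
    have "((\<lambda>v. ?q (- v)) has_derivative (\<lambda>u. - frechet_derivative ?q (at 0) u)) (at 0)"
      by (rule has_derivative_reflect) (use d in simp)
    from pd_eq[OF has_derivative_diff[OF has_derivative_minus[OF this] d]]
    show ?thesis by simp
  qed
  have "flat (Suc 0) (pd i (\<lambda>v. k (- v) - k v)) 0" for i
    by (subst flat_cong[OF assms(1,2) 1]) (auto simp: 2 assms(5))
  then show ?thesis by (simp add: numeral_2_eq_2)
qed

text \<open>The inverse function theorem delivers the derivative as \<open>inv\<close> of a linear
  bijection, while the bootstrap above needs a matrix inverse.\<close>

lemma inv_eq_matrix_inv:
  fixes f :: "real^'n \<Rightarrow> real^'n"
  assumes "linear f" "bij f"
  shows "invertible (matrix f)" "inv f = (\<lambda>v. matrix_inv (matrix f) *v v)"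
proof -
  have f: "(*v) (matrix f) = f" using matrix_vector_mul(2)[OF assms(1)] .
  show i: "invertible (matrix f)"
    unfolding invertible_eq_bij f by fact
  have "f (matrix_inv (matrix f) *v v) = v" for v
  proof -
    have "matrix f *v (matrix_inv (matrix f) *v v) = v"
      unfolding matrix_vector_mul_assoc matrix_inv_mult[OF i] by (rule matrix_vector_mul_lid)
    then show ?thesis unfolding f .
  qed
  then show "inv f = (\<lambda>v. matrix_inv (matrix f) *v v)"
    using bij_inv_eq_iff[OF assms(2)] by (intro ext) (metis)
qed

text \<open>
  The coordinates \<open>\<psi> u = (u - a) + \<Gamma>(u - a, u - a) / 2\<close> kill the first derivatives of the metric
  at \<open>a\<close>.
\<close>

definition quad_map :: "(real^'n \<Rightarrow> real^'n \<Rightarrow> real^'n) \<Rightarrow> real^'n::finite \<Rightarrow> real^'n \<Rightarrow> real^'n" where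
  "quad_map B a u = (u - a) + (1/2) *\<^sub>R B (u - a) (u - a)"

text \<open>Symmetry of \<open>B\<close> merges the two product-rule terms and cancels the factor
  1/2. At \<open>u = a\<close> the derivative is the identity.\<close>

lemma quad_map_has_derivative:
  assumes B: "bounded_bilinear B" and sym: "\<And>u v. B u v = B v u"
  shows "(quad_map B a has_derivative (\<lambda>v. v + B (u - a) v)) (at u)"
proof -
  have d: "((\<lambda>u. u - a) has_derivative (\<lambda>v. v - 0)) (at u)"
    by (intro has_derivative_diff has_derivative_ident has_derivative_const)
  have "(quad_map B a has_derivative
      (\<lambda>v. (v - 0) + (1/2) *\<^sub>R (B (u - a) (v - 0) + B (v - 0) (u - a)))) (at u)"
    unfolding quad_map_def[abs_def]
    by (intro has_derivative_add has_derivative_scaleR_right bounded_bilinear.FDERIV[OF B] d)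
  then show ?thesis
    by (simp add: sym[of _ "u - a"] flip: scaleR_2)
qed

lemma Ck_on_quad_map:
  assumes B: "bounded_bilinear B"
  shows "Ck_on k UNIV (quad_map B a)"
proof -
  have d: "Ck_on k UNIV (\<lambda>u. u - a)"
    using Ck_on_add[OF open_UNIV Ck_on_ident[OF open_UNIV] Ck_on_const, of k "- a"] by simp
  show ?thesis unfolding quad_map_def[abs_def]
    by (rule Ck_on_add[OF open_UNIV d Ck_on_linear[OF bounded_linear_scaleR_right open_UNIV
            Ck_on_bilinear[OF B open_UNIV d d]]])
qed

text \<open>The derivative at \<open>a\<close> is the identity, so the inverse function theorem
  applies. Cutting the target down to a ball about 0 makes \<open>W\<close> stable under negation,
  and taking its preimage as \<open>V\<close> keeps the two maps mutually inverse.\<close>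

lemma quad_map_local_inverse:
  fixes a :: "real^'n"
  assumes B: "bounded_bilinear B" and sym: "\<And>u v. B u v = B v u" and "open S" "a \<in> S"
  obtains V W g where "open V" "a \<in> V" "V \<subseteq> S" "open W" "0 \<in> W" "\<And>v. v \<in> W \<Longrightarrow> - v \<in> W"
    "quad_map B a ` V \<subseteq> W" "g ` W \<subseteq> V" "\<And>u. u \<in> V \<Longrightarrow> g (quad_map B a u) = u"
    "\<And>v. v \<in> W \<Longrightarrow> quad_map B a (g v) = v" "smooth_on W g"
proof -
  let ?\<psi> = "quad_map B a"
  define f' where "f' u = id_blinfun + Blinfun (B (u - a))" for u
  have f': "blinfun_apply (f' u) = (\<lambda>v. v + B (u - a) v)" for u
    unfolding f'_def
    by (simp add: plus_blinfun.rep_eq bounded_linear_Blinfun_apply bounded_bilinear.bounded_linear_right[OF B] fun_eq_iff)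
  have cont: "continuous_on S f'"
    by (rule continuous_on_blinfun_componentwise) 
      (simp add: f', intro continuous_intros bounded_bilinear.continuous_on[OF B])
  have inv: "id_blinfun o\<^sub>L f' a = id_blinfun"
    by (rule blinfun_eqI) (simp add: f' bounded_bilinear.zero_left[OF B])
  have der: "(?\<psi> has_derivative blinfun_apply (f' u)) (at u)" for u
    unfolding f' by (rule quad_map_has_derivative[OF B sym])
  obtain U' V0 g g' where U': "open U'" "U' \<subseteq> S" "a \<in> U'" "open V0" "?\<psi> a \<in> V0"
    and hom: "homeomorphism U' V0 ?\<psi> g"
    and g': "\<And>y. y \<in> V0 \<Longrightarrow> (g has_derivative (g' y)) (at y)"
      "\<And>y. y \<in> V0 \<Longrightarrow> g' y = inv (blinfun_apply (f' (g y)))"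
      "\<And>y. y \<in> V0 \<Longrightarrow> bij (blinfun_apply (f' (g y)))"
    by (rule inverse_function_theorem[OF assms(3) der cont assms(4) inv]) blast
  have z: "?\<psi> a = 0" by (simp add: quad_map_def bounded_bilinear.zero_left[OF B])
  obtain \<rho> where \<rho>: "\<rho> > 0" "ball 0 \<rho> \<subseteq> V0"
    using U'(4,5) z by (metis open_contains_ball)
  define V where "V = U' \<inter> ?\<psi> -` ball 0 \<rho>"
  have c\<psi>: "continuous_on UNIV ?\<psi>" using Ck_on_quad_map[OF B, of 0] by simp
  have hom': "g v \<in> U'" "?\<psi> (g v) = v" if "v \<in> ball 0 \<rho>" for v
    using hom \<rho>(2) that by (auto simp: homeomorphism_def)
  have hom'': "g (?\<psi> u) = u" if "u \<in> U'" for u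
    using hom that by (auto simp: homeomorphism_def)
  have lin: "linear (\<lambda>v. v + B (u - a) v)" for u
    by (rule has_derivative_linear[OF quad_map_has_derivative[OF B sym]])
  define D where "D = jmat ?\<psi>"
  have D: "D u = matrix (\<lambda>v. v + B (u - a) v)" for u
    unfolding D_def by (rule jmat_eq[OF quad_map_has_derivative[OF B sym]])
  \<comment> \<open>The inverse function theorem yields only the first derivative of
    \<open>g\<close>; the bootstrap raises this to all orders.\<close>
  have Cg: "Ck_on k (ball 0 \<rho>) g" for k
  proof (rule Ck_on_inverse_function[where D = D and U = UNIV])
    show "Ck_on k UNIV D" for k
      unfolding D_def by (rule Ck_on_jmat[OF open_UNIV Ck_on_quad_map[OF B]])
    fix y :: "real^'n" assume "y \<in> ball 0 \<rho>"
    then have y: "y \<in> V0" using \<rho> by auto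
    have b: "bij (\<lambda>v. v + B (g y - a) v)" using g'(3)[OF y] by (simp add: f')
    show "invertible (D (g y))" unfolding D by (rule inv_eq_matrix_inv[OF lin b])
    show "(g has_derivative (\<lambda>v. matrix_inv (D (g y)) *v v)) (at y)"
      using g'(1,2)[OF y] unfolding D inv_eq_matrix_inv(2)[OF lin b, symmetric] f' by simp
  qed auto
  show thesis
  proof (rule that[of V "ball 0 \<rho>" g])
    show "open V" unfolding V_def using U'(1) c\<psi>
      by (intro open_Int open_vimage) (auto simp: continuous_on_eq_continuous_at)
    show "smooth_on (ball 0 \<rho>) g" unfolding smooth_on_def using Cg by blast
  qed (use U' \<rho> z hom' hom'' in \<open>auto simp: V_def\<close>)
qed

lemma pd_symmetric_matrix:
  fixes h :: "real^'n \<Rightarrow> real^'m^'m"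
  assumes "open S" "a \<in> S" "h differentiable (at a)" "\<And>y. y \<in> S \<Longrightarrow> transpose (h y) = h y"
  shows "transpose (pd k h a) = pd k h a"
proof -
  have "pd k (\<lambda>y. transpose (h y)) a = transpose (pd k h a)"
    unfolding pd_def[of k h]
    by (rule pd_eq[OF bounded_linear.has_derivative[OF bounded_linear_transpose]])
      (use assms(3) in \<open>simp add: frechet_derivative_works\<close>)
  from trans[OF this[symmetric] pd_cong_open[OF assms(1,2,4)]] show ?thesis .
qed

definition bilin :: "('n \<Rightarrow> 'n \<Rightarrow> 'n \<Rightarrow> real) \<Rightarrow> real^'n::finite \<Rightarrow> real^'n \<Rightarrow> real^'n" where
  "bilin \<Gamma> u v = (\<chi> i. \<Sum>k\<in>UNIV. \<Sum>l\<in>UNIV. \<Gamma> i k l * u $ k * v $ l)"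

lemma bounded_bilinear_bilin: "bounded_bilinear (bilin \<Gamma>)"
  unfolding bilinear_conv_bounded_bilinear[symmetric] bilinear_def bilin_def
  by (intro conjI allI linearI)
    (simp_all add: vec_eq_iff algebra_simps sum.distrib sum_distrib_left)

lemma bilin_commute:
  assumes "\<And>i k l. \<Gamma> i k l = \<Gamma> i l k"
  shows "bilin \<Gamma> u v = bilin \<Gamma> v u"
proof -
  have "(\<Sum>k\<in>UNIV. \<Sum>l\<in>UNIV. \<Gamma> i k l * u $ k * v $ l) = (\<Sum>k\<in>UNIV. \<Sum>l\<in>UNIV. \<Gamma> i k l * v $ k * u $ l)" for i
    by (subst sum.swap) (simp add: assms[of i] mult.assoc mult.commute[of "u $ _"])
  then show ?thesis by (simp add: bilin_def)
qed

lemma bilin_axis: "bilin \<Gamma> (axis k 1) (axis l 1) $ i = \<Gamma> i k l"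
proof -
  have "(\<Sum>k'\<in>UNIV. \<Sum>l'\<in>UNIV. \<Gamma> i k' l' * axis k 1 $ k' * axis l 1 $ l') =
      (\<Sum>k'\<in>UNIV. \<Sum>l'\<in>UNIV. if k' = k then if l' = l then \<Gamma> i k l else 0 else 0)"
    by (intro sum.cong refl) (auto simp: axis_def)
  also have "\<dots> = (\<Sum>k'\<in>UNIV. if k' = k then \<Sum>l'\<in>UNIV. if l' = l then \<Gamma> i k l else 0 else 0)"
    by (intro sum.cong refl) auto
  also have "\<dots> = \<Gamma> i k l" by simp
  finally show ?thesis by (simp add: bilin_def)
qed

text \<open>Differentiating the pull-back of the constant matrix \<open>h a\<close> at
  \<open>a\<close>, where the Jacobian is the identity, gives exactly the Christoffel terms in the
  equation that makes the metric parallel. The comparison is made before passing to the coordinates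
  \<open>quad_map\<close>, so that the inverse map need not be differentiated.\<close>

lemma flat_normal_coordinates:
  fixes h :: "real^'n \<Rightarrow> real^'n^'n"
  assumes h: "h differentiable (at a)"
    and \<Gamma>: "levi_civita_coeffs (h a) (\<chi> k. pd k h a) \<Gamma>"
  shows "flat 1 (\<lambda>u. h u - pullback (quad_map (bilin \<Gamma>) a) (\<lambda>_. h a) u) a"
proof -
  let ?B = "bilin \<Gamma>" and ?\<psi> = "quad_map (bilin \<Gamma>) a"
  \<comment> \<open>The Jacobian of \<open>?\<psi>\<close> at \<open>u\<close> is the identity plus
    \<open>E (u - a)\<close>; the entry (i, l) of \<open>E (axis k 1)\<close> is
    \<open>\<Gamma> i k l\<close>.\<close>
  define E where "E v = matrix (?B v)" for v
  have sym: "\<Gamma> i k l = \<Gamma> i l k" for i k l using \<Gamma> unfolding levi_civita_coeffs_def by blast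
  note B = bounded_bilinear_bilin[of \<Gamma>]
  have E: "bounded_linear E"
    unfolding linear_conv_bounded_linear[symmetric] E_def matrix_def
    by (intro linearI) (simp_all add: vec_eq_iff bounded_bilinear.add_left[OF B] bounded_bilinear.scaleR_left[OF B])
  have "matrix (\<lambda>v. v + ?B w v) = mat 1 + E w" for w
    by (simp add: E_def matrix_def vec_eq_iff mat_def axis_def)
  then have J: "jmat ?\<psi> = (\<lambda>u. mat 1 + E (u - a))"
    using jmat_eq[OF quad_map_has_derivative[OF B bilin_commute[of \<Gamma>, OF sym]]] by (intro ext) simp
  have Ja: "jmat ?\<psi> a = mat 1" unfolding J by (simp add: linear_0[OF bounded_linear.linear[OF E]])
  have Jd: "(jmat ?\<psi> has_derivative E) (at a)"
  proof -
    have "((\<lambda>u. mat 1 + E (u - a)) has_derivative (\<lambda>v. 0 + E (v - 0))) (at a)"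
      by (intro has_derivative_add has_derivative_const bounded_linear.has_derivative[OF E]
          has_derivative_diff has_derivative_ident)
    then show ?thesis unfolding J by simp
  qed
  note M = bounded_bilinear.FDERIV[OF bounded_bilinear_matrix_mult]
  have d: "(pullback ?\<psi> (\<lambda>_. h a) has_derivative
      (\<lambda>v. transpose (jmat ?\<psi> a) ** h a ** E v +
        (transpose (jmat ?\<psi> a) ** 0 + transpose (E v) ** h a) ** jmat ?\<psi> a)) (at a)"
    unfolding pullback_def[abs_def]
    by (rule M[OF M[OF bounded_linear.has_derivative[OF bounded_linear_transpose Jd] has_derivative_const] Jd])
  have "pd k (\<lambda>u. h u - pullback ?\<psi> (\<lambda>_. h a) u) a = pd k h a - (h a ** E (axis k 1) + transpose (E (axis k 1)) ** h a)" for k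
    using pd_eq[OF has_derivative_diff[OF frechet_derivative_works[THEN iffD1, OF h] d], of k]
    by (simp add: Ja pd_def transpose_mat)
  \<comment> \<open>Read entrywise, this is the compatibility equation in
    \<open>levi_civita_coeffs\<close>.\<close>
  moreover have "pd k h a = h a ** E (axis k 1) + transpose (E (axis k 1)) ** h a" for k
  proof -
    have "pd k h a $ i $ j = (\<Sum>m\<in>UNIV. \<Gamma> m k i * h a $ m $ j) + (\<Sum>m\<in>UNIV. \<Gamma> m k j * h a $ i $ m)" for i j
    proof -
      have "(\<chi> k. pd k h a) $ k $ i $ j - (\<Sum>m\<in>UNIV. \<Gamma> m k i * h a $ m $ j) - (\<Sum>m\<in>UNIV. \<Gamma> m k j * h a $ i $ m) = 0"
        using \<Gamma> unfolding levi_civita_coeffs_def by blast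
      then show ?thesis by simp
    qed
    then show ?thesis
      by (simp add: vec_eq_iff matrix_matrix_mult_def E_def matrix_def transpose_def bilin_axis mult.commute)
  qed
  ultimately show ?thesis by (simp add: pullback_def Ja transpose_mat)
qed

section \<open>The symmetry in a single chart\<close>

lemma jmat_uminus: "jmat uminus v = - mat 1"
proof -
  have "(uminus has_derivative uminus) (at v)"
    using has_derivative_minus[OF has_derivative_ident] .
  from jmat_eq[OF this] show ?thesis by (simp add: matrix_def vec_eq_iff mat_def axis_def)
qed

text \<open>A conjugate of the negation is an involution because \<open>\<psi>\<close> maps
  \<open>V\<close> bijectively onto a set stable under negation. In the \<open>\<psi>\<close>
  coordinates the change of the metric is \<open>K (- v) - K v\<close>, whose 2-jet is zero by
  parity once the first derivatives of \<open>K\<close> vanish.\<close>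

lemma geodesic_symmetry:
  fixes h :: "real^'n \<Rightarrow> real^'n^'n"
  assumes "open S" "a \<in> S" "smooth_on S h" "\<And>y. y \<in> S \<Longrightarrow> transpose (h y) = h y" "invertible (h a)"
  obtains V \<theta> where "open V" "a \<in> V" "V \<subseteq> S" "\<theta> ` V \<subseteq> V" "\<And>u. u \<in> V \<Longrightarrow> \<theta> (\<theta> u) = u"
    "smooth_on V \<theta>" "\<theta> a = a" "jmat \<theta> a = - mat 1" "flat 2 (\<lambda>u. pullback \<theta> h u - h u) a"
proof -
  have Ch: "Ck_on k S h" for k using assms(3) by (simp add: smooth_on_def)
  have hd: "h differentiable (at u)" if "u \<in> S" for u using Ch[of "Suc 0"] that by simp
  have "transpose ((\<chi> k. pd k h a) $ k) = (\<chi> k. pd k h a) $ k" for k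
    using pd_symmetric_matrix[OF assms(1,2) hd[OF assms(2)] assms(4)] by simp
  then obtain \<Gamma> where \<Gamma>: "levi_civita_coeffs (h a) (\<chi> k. pd k h a) \<Gamma>"
    using levi_civita_unique[OF assms(4)[OF assms(2)] assms(5)] by blast
  have sym: "\<Gamma> i k l = \<Gamma> i l k" for i k l using \<Gamma> unfolding levi_civita_coeffs_def by blast
  define \<psi> where "\<psi> = quad_map (bilin \<Gamma>) a"
  note B = bounded_bilinear_bilin[of \<Gamma>]
  obtain V W g where V: "open V" "a \<in> V" "V \<subseteq> S" and W: "open W" "0 \<in> W" "\<And>v. v \<in> W \<Longrightarrow> - v \<in> W"
    and \<psi>g: "\<psi> ` V \<subseteq> W" "g ` W \<subseteq> V" "\<And>u. u \<in> V \<Longrightarrow> g (\<psi> u) = u" "\<And>v. v \<in> W \<Longrightarrow> \<psi> (g v) = v"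
    and "smooth_on W g"
    using quad_map_local_inverse[OF B bilin_commute[of \<Gamma>, OF sym] assms(1,2)] unfolding \<psi>_def by blast
  have Cg: "Ck_on k W g" for k using \<open>smooth_on W g\<close> by (simp add: smooth_on_def)
  have C\<psi>: "Ck_on k T \<psi>" for k T using Ck_on_subset[OF Ck_on_quad_map[OF B]] unfolding \<psi>_def by blast
  have ChV: "Ck_on k V h" for k by (rule Ck_on_subset[OF Ch V(3)])
  have gd: "g differentiable (at v)" if "v \<in> W" for v using Cg[of "Suc 0"] that by simp
  have \<psi>d: "\<psi> differentiable (at u)" for u using C\<psi>[of "Suc 0" UNIV] by simp
  have \<psi>a: "\<psi> a = 0" by (simp add: \<psi>_def quad_map_def bounded_bilinear.zero_left[OF B])
  have g0: "g 0 = a" using \<psi>g(3)[OF V(2)] \<psi>a by simp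

  \<comment> \<open>\<open>K\<close> is the metric in the coordinates \<open>\<psi>\<close>. The
    defect \<open>q\<close> compares \<open>h\<close> with a metric that is constant in these
    coordinates; pulling \<open>q\<close> back along \<open>g\<close> turns it into \<open>K\<close>
    minus a constant, so its first-order vanishing becomes that of the derivatives of
    \<open>K\<close> at 0.\<close>
  define K where "K = pullback g h"
  define q where "q = (\<lambda>u. h u - pullback \<psi> (\<lambda>_. h a) u)"
  have CK: "Ck_on k W K" for k
    unfolding K_def by (rule Ck_on_pullback[OF W(1) V(1) \<psi>g(2) Cg ChV])
  have Cq: "Ck_on k V q" for k
  proof -
    have "Ck_on k V (pullback \<psi> (\<lambda>_. h a))"
      by (rule Ck_on_pullback[OF V(1) open_UNIV _ C\<psi> Ck_on_const]) simp
    then have "Ck_on k V (\<lambda>u. h u + - pullback \<psi> (\<lambda>_. h a) u)"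
      by (rule Ck_on_add[OF V(1) ChV Ck_on_linear[OF bounded_linear_minus[OF bounded_linear_ident] V(1)]])
    then show ?thesis by (simp add: q_def)
  qed
  have Kq: "pullback g q v = K v - h a" if "v \<in> W" for v
  proof -
    have "pullback g (pullback \<psi> (\<lambda>_. h a)) v = pullback (\<lambda>v. \<psi> (g v)) (\<lambda>_. h a) v"
      by (rule pullback_compose[OF gd[OF that] \<psi>d])
    also have "\<dots> = pullback (\<lambda>v. v) (\<lambda>_. h a) v"
      by (rule pullback_cong_open[OF W(1) that \<psi>g(4)])
    finally show ?thesis unfolding q_def pullback_diff K_def by (simp add: pullback_ident)
  qed
  have "flat 1 q a"
    unfolding q_def \<psi>_def by (rule flat_normal_coordinates[OF hd[OF assms(2)] \<Gamma>])
  then have "flat 1 (pullback g q) 0"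
    by (intro flat_pullback[OF W(1) V(1) \<psi>g(2) W(2) Cg Cq]) (simp add: g0)
  then have "flat 1 (\<lambda>v. K v - h a) 0"
    using flat_cong[of W 0 "pullback g q" "\<lambda>v. K v - h a" 1, OF W(1,2) Kq] by blast
  moreover have "pd i (\<lambda>v. K v - h a) 0 = pd i K 0 - 0" for i
    unfolding pd_def[of i K]
    by (rule pd_eq[OF has_derivative_diff[OF Ck_on_Suc_has_derivative[OF CK W(2)] has_derivative_const]])
  ultimately have "pd i K 0 = 0" for i by simp
  then have fK: "flat 2 (\<lambda>v. K (- v) - K v) 0"
    by (intro flat_odd_part[OF W CK])

  define \<theta> where "\<theta> u = g (- \<psi> u)" for u
  have neg: "uminus ` W \<subseteq> W" using W(3) by auto
  have Cneg: "Ck_on k W uminus" for k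
    using Ck_on_linear[OF bounded_linear_minus[OF bounded_linear_ident] W(1) Ck_on_ident[OF W(1)]] .
  have dneg: "uminus differentiable (at v)" for v :: "real^'n"
    unfolding differentiable_def using has_derivative_minus[OF has_derivative_ident] by blast
  have Cgn: "Ck_on k W (\<lambda>v. g (- v))" for k
    by (rule Ck_on_compose[OF W(1) W(1) neg Cg Cneg])
  have gnd: "(\<lambda>v. g (- v)) differentiable (at v)" if "v \<in> W" for v
    using Cgn[of "Suc 0"] that by simp
  have C\<theta>: "Ck_on k V \<theta>" for k
    unfolding \<theta>_def[abs_def] by (rule Ck_on_compose[OF V(1) W(1) \<psi>g(1) Cgn C\<psi>])
  have pullback\<theta>: "pullback \<psi> (\<lambda>v. K (- v) - K v) u = pullback \<theta> h u - h u" if u: "u \<in> V" for u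
  proof -
    have W': "\<psi> u \<in> W" using u \<psi>g(1) by auto
    have "pullback \<psi> K u = pullback (\<lambda>u. g (\<psi> u)) h u"
      unfolding K_def by (rule pullback_compose[OF \<psi>d gd[OF W']])
    also have "\<dots> = pullback (\<lambda>u. u) h u" by (rule pullback_cong_open[OF V(1) u \<psi>g(3)])
    finally have 1: "pullback \<psi> K u = h u" by (simp add: pullback_ident)
    \<comment> \<open>The two signs from the Jacobian cancel, so reflecting the argument alone
      already is the pull-back.\<close>
    have "K (- v) = pullback uminus K v" for v
      unfolding pullback_def jmat_uminus
      by (simp add: vec_eq_iff matrix_matrix_mult_def transpose_def mat_def if_distrib if_distribR sum_negf cong: if_cong)
    then have "pullback \<psi> (\<lambda>v. K (- v)) u = pullback \<psi> (pullback uminus (pullback g h)) u" by (simp add: K_def)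
    also have "\<dots> = pullback (\<lambda>u. - \<psi> u) (pullback g h) u" by (rule pullback_compose[OF \<psi>d dneg])
    also have "\<dots> = pullback (\<lambda>u. g (- \<psi> u)) h u"
      by (rule pullback_compose[where F = "\<lambda>u. - \<psi> u", OF _ gd[OF W(3)[OF W']]])
        (rule differentiable_minus[OF \<psi>d])
    finally have 2: "pullback \<psi> (\<lambda>v. K (- v)) u = pullback \<theta> h u" by (simp add: \<theta>_def[abs_def])
    show ?thesis unfolding pullback_diff 1 2 ..
  qed
  have "flat 2 (pullback \<psi> (\<lambda>v. K (- v) - K v)) a"
  proof (rule flat_pullback[OF V(1) W(1) \<psi>g(1) V(2) C\<psi>])
    have "Ck_on 2 W (\<lambda>v. K (- v) + - K v)"
      by (rule Ck_on_add[OF W(1) Ck_on_compose[OF W(1) W(1) neg CK Cneg]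
            Ck_on_linear[OF bounded_linear_minus[OF bounded_linear_ident] W(1) CK]])
    then show "Ck_on 2 W (\<lambda>v. K (- v) - K v)" by simp
  qed (use fK \<psi>a in simp)
  then have flat: "flat 2 (\<lambda>u. pullback \<theta> h u - h u) a"
    using flat_cong[of V a _ "\<lambda>u. pullback \<theta> h u - h u" 2, OF V(1,2) pullback\<theta>] by blast
  \<comment> \<open>Minus the identity is central, so conjugating it by these two inverse Jacobians
    leaves it unchanged.\<close>
  have "jmat g (\<psi> a) ** jmat \<psi> a = mat 1"
    using jmat_compose[of \<psi> a g, OF \<psi>d gd] jmat_cong_open[of V a "\<lambda>u. g (\<psi> u)" "\<lambda>u. u", OF V(1,2) \<psi>g(3)]
    by (simp add: jmat_ident \<psi>a W(2))
  moreover have "jmat \<theta> a = jmat g (- \<psi> a) ** (jmat uminus (\<psi> a) ** jmat \<psi> a)"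
  proof -
    have "jmat \<theta> a = jmat g (- \<psi> a) ** jmat (\<lambda>u. - \<psi> u) a"
      unfolding \<theta>_def[abs_def]
      by (rule jmat_compose[of "\<lambda>u. - \<psi> u" a g, OF differentiable_minus[OF \<psi>d]]) (simp add: \<psi>a gd W(2))
    also have "jmat (\<lambda>u. - \<psi> u) a = jmat uminus (\<psi> a) ** jmat \<psi> a"
      by (rule jmat_compose[OF \<psi>d dneg])
    finally show ?thesis .
  qed
  moreover have "- mat 1 ** jmat \<psi> a = - jmat \<psi> a" "jmat g 0 ** - jmat \<psi> a = - (jmat g 0 ** jmat \<psi> a)"
    by (simp_all add: vec_eq_iff matrix_matrix_mult_def mat_def if_distrib if_distribR sum_negf cong: if_cong)
  ultimately have J: "jmat \<theta> a = - mat 1" by (simp add: \<psi>a jmat_uminus)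
  show thesis
  proof (rule that[of V \<theta>])
    have *: "- \<psi> u \<in> W" if "u \<in> V" for u using that \<psi>g(1) W(3) by auto
    then show "\<theta> ` V \<subseteq> V" using \<psi>g(2) by (auto simp: \<theta>_def)
    show "\<theta> (\<theta> u) = u" if "u \<in> V" for u
      using \<psi>g(4)[OF *[OF that]] \<psi>g(3)[OF that] by (simp add: \<theta>_def)
    show "smooth_on V \<theta>" using C\<theta> by (simp add: smooth_on_def)
    show "\<theta> a = a" by (simp add: \<theta>_def \<psi>a g0)
  qed (use V J flat in auto)
qed

subsection \<open>Charts\<close>

lemma smooth_on_cong:
  assumes "open S" "\<And>y. y \<in> S \<Longrightarrow> f y = g y"
  shows "smooth_on S f \<longleftrightarrow> smooth_on S g"
  unfolding smooth_on_def using Ck_on_cong[of S f g, OF assms] by blast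

lemma smooth_on_compose:
  fixes f :: "'e::euclidean_space \<Rightarrow> 'f::real_normed_vector"
  assumes "open S" "open T" "\<phi> ` S \<subseteq> T" "smooth_on T f" "smooth_on S \<phi>"
  shows "smooth_on S (\<lambda>x. f (\<phi> x))"
  using assms(4,5) unfolding smooth_on_def by (blast intro: Ck_on_compose[OF assms(1-3)])

lemma smooth_on_restrict: "smooth_on S f \<Longrightarrow> T \<subseteq> S \<Longrightarrow> smooth_on T f"
  unfolding smooth_on_def by (blast intro: Ck_on_subset)

lemma smooth_on_differentiable: "smooth_on S f \<Longrightarrow> x \<in> S \<Longrightarrow> f differentiable (at x)"
  unfolding smooth_on_def using Ck_on.simps(2) by blast

lemma jac_jmat: "jac \<tau> c d x = jmat (\<lambda>y. snd d (\<tau> (cinv c y))) (snd c x)"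
  by (simp add: jac_def jmat_def o_def)

lemma cinv_chart:
  assumes "y \<in> snd c ` fst c"
  shows "cinv c y \<in> fst c" "snd c (cinv c y) = y"
  using assms unfolding cinv_def by (auto intro: inv_into_into f_inv_into_f)

context
  fixes X :: "'a topology" and A :: "('a, 'n::finite) chart set"
  assumes M: "smooth_manifold X A"
begin

lemma chart_open: "c \<in> A \<Longrightarrow> openin X (fst c)"
  using M unfolding smooth_manifold_def by blast

lemma chart_homeo:
  "c \<in> A \<Longrightarrow> homeomorphic_map (subtopology X (fst c)) (top_of_set (snd c ` fst c)) (snd c)"
  using M unfolding smooth_manifold_def by blast

lemma chart_image_open: "c \<in> A \<Longrightarrow> open (snd c ` fst c)"
  using M unfolding smooth_manifold_def by blast

lemma chart_topspace: "c \<in> A \<Longrightarrow> topspace (subtopology X (fst c)) = fst c"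
  using openin_subset[OF chart_open] by (simp add: Int_absorb1)

lemma chart_cinv: "c \<in> A \<Longrightarrow> x \<in> fst c \<Longrightarrow> cinv c (snd c x) = x"
  using homeomorphic_imp_injective_map[OF chart_homeo[of c]] chart_topspace[of c]
  unfolding cinv_def by (simp add: inv_into_f_f)

lemma open_chart_image:
  assumes "c \<in> A" "openin X U" shows "open (snd c ` (U \<inter> fst c))"
proof -
  have "openin (subtopology X (fst c)) (U \<inter> fst c)"
    using assms(2) by (auto simp: openin_subtopology)
  then have "openin (top_of_set (snd c ` fst c)) (snd c ` (U \<inter> fst c))"
    using homeomorphic_imp_open_map[OF chart_homeo[OF assms(1)]] unfolding open_map_def by blast
  then show ?thesis using chart_image_open[OF assms(1)] by (simp add: openin_open_eq)
qed

lemma open_cinv_image: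
  assumes "c \<in> A" "open V" "V \<subseteq> snd c ` fst c" shows "openin X (cinv c ` V)"
proof -
  have "openin (subtopology X (fst c)) {x \<in> topspace (subtopology X (fst c)). snd c x \<in> V}"
  proof (rule openin_continuous_map_preimage)
    show "continuous_map (subtopology X (fst c)) (top_of_set (snd c ` fst c)) (snd c)"
      by (rule homeomorphic_imp_continuous_map[OF chart_homeo[OF assms(1)]])
    show "openin (top_of_set (snd c ` fst c)) V"
      using assms chart_image_open by (simp add: openin_open_eq)
  qed
  moreover have "{x \<in> topspace (subtopology X (fst c)). snd c x \<in> V} = cinv c ` V"
  proof -
    have "cinv c v \<in> fst c" "snd c (cinv c v) = v" if "v \<in> V" for v
      using cinv_chart[of v c] that assms(3) by blast+
    then have "cinv c ` V \<subseteq> {x \<in> fst c. snd c x \<in> V}" by auto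
    moreover have "x \<in> cinv c ` V" if "x \<in> fst c" "snd c x \<in> V" for x
      using chart_cinv[OF assms(1) that(1)] that(2) by (metis imageI)
    ultimately show ?thesis unfolding chart_topspace[OF assms(1)] by blast
  qed
  ultimately show ?thesis
    using openin_open_subtopology[OF chart_open[OF assms(1)]] by simp
qed

lemma transition_smooth:
  "c \<in> A \<Longrightarrow> d \<in> A \<Longrightarrow> smooth_on (snd c ` (fst c \<inter> fst d)) (\<lambda>y. snd d (cinv c y))"
  using M unfolding smooth_manifold_def by (simp add: o_def)

lemma transition_domain_open: "c \<in> A \<Longrightarrow> d \<in> A \<Longrightarrow> open (snd c ` (fst c \<inter> fst d))"
  using open_chart_image[OF _ chart_open, of c d] by (simp add: Int_commute)

lemma chart_at_in: "x \<in> topspace X \<Longrightarrow> chart_at A x \<in> charts_at A x"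
proof -
  assume "x \<in> topspace X"
  moreover have "(\<Union>c\<in>A. fst c) = topspace X" using M unfolding smooth_manifold_def by blast
  ultimately obtain c where "c \<in> A" "x \<in> fst c" by blast
  then have "c \<in> charts_at A x" by (simp add: charts_at_def)
  then show ?thesis unfolding chart_at_def by (rule someI)
qed

end

section \<open>Local involutions as diffeomorphisms, and equality of jets\<close>

lemma involution_inv_into:
  assumes "\<tau> ` V \<subseteq> V" "\<And>y. y \<in> V \<Longrightarrow> \<tau> (\<tau> y) = y" "y \<in> V"
  shows "inv_into V \<tau> y = \<tau> y"
proof (rule inv_into_f_eq)
  show "inj_on \<tau> V" using assms(2) by (metis inj_onI)
qed (use assms in auto)

text \<open>An involution is its own inverse, so one continuity and one smoothness condition cover
  both directions. Since \<open>inv_into V \<tau>\<close> is known to agree with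
  \<open>\<tau>\<close> only on \<open>V\<close>, smoothness is transferred on the open coordinate
  domains; \<open>pre\<close> gives their openness as well as continuity.\<close>

lemma diffeo_involution:
  assumes M: "smooth_manifold X A" and V: "openin X V" "\<tau> ` V \<subseteq> V" "\<And>y. y \<in> V \<Longrightarrow> \<tau> (\<tau> y) = y"
    and pre: "\<And>T. openin X T \<Longrightarrow> openin X {y \<in> V. \<tau> y \<in> T}" and sm: "smooth_map_on A V \<tau>"
  shows "diffeo X A V V \<tau>"
proof -
  have tV: "topspace (subtopology X V) = V" using openin_subset[OF V(1)] by (simp add: Int_absorb1)
  have "continuous_map (subtopology X V) (subtopology X V) \<tau>"
    unfolding continuous_map_def tV
  proof (intro conjI allI impI)
    fix T assume "openin (subtopology X V) T"
    then have "openin X T" using openin_open_subtopology[OF V(1)] by blast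
    from pre[OF this] show "openin (subtopology X V) {y \<in> V. \<tau> y \<in> T}"
      unfolding openin_open_subtopology[OF V(1)] by auto
  qed (use V(2) in auto)
  then have "homeomorphic_maps (subtopology X V) (subtopology X V) \<tau> \<tau>"
    using V(3) unfolding homeomorphic_maps_def tV by blast
  then have h: "homeomorphic_map (subtopology X V) (subtopology X V) \<tau>"
    by (rule homeomorphic_maps_map[THEN iffD1, THEN conjunct1])
  note inv = involution_inv_into[of \<tau> V, OF V(2,3)]
  have "smooth_map_on A V (inv_into V \<tau>)"
    unfolding smooth_map_on_def
  proof (intro ballI)
    fix c d assume c: "c \<in> A" "d \<in> A"
    have eq: "{x \<in> V. x \<in> fst c \<and> inv_into V \<tau> x \<in> fst d} = {x \<in> V. x \<in> fst c \<and> \<tau> x \<in> fst d}" (is "?L = ?Q")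
      using inv by auto
    have "?Q = {y \<in> V. \<tau> y \<in> fst d} \<inter> fst c" by auto
    then have o: "open (snd c ` ?Q)"
      using open_chart_image[OF M c(1) pre[OF chart_open[OF M c(2)]]] by simp
    have "smooth_on (snd c ` ?Q) (snd d \<circ> \<tau> \<circ> cinv c)"
      using sm c unfolding smooth_map_on_def by blast
    moreover have "(snd d \<circ> inv_into V \<tau> \<circ> cinv c) y = (snd d \<circ> \<tau> \<circ> cinv c) y" if "y \<in> snd c ` ?Q" for y
      using that inv by (auto simp: chart_cinv[OF M c(1)])
    ultimately show "smooth_on (snd c ` ?L) (snd d \<circ> inv_into V \<tau> \<circ> cinv c)"
      unfolding eq using smooth_on_cong[OF o, of "snd d \<circ> inv_into V \<tau> \<circ> cinv c" "snd d \<circ> \<tau> \<circ> cinv c"] by blast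
  qed
  then show ?thesis unfolding diffeo_def using V(1) h sm by blast
qed

text \<open>Translates a flat difference back into the three components recorded by
  \<open>jet2\<close>. The first derivatives must be compared on all of \<open>R\<close>, because
  they are differentiated once more.\<close>

lemma flat_imp_equal_derivatives:
  assumes R: "open R" "b \<in> R" "\<And>w. w \<in> R \<Longrightarrow> k' w = k w + \<delta> w"
    and C: "Ck_on 2 R k" "Ck_on 2 R \<delta>" and fl: "flat 2 \<delta> b"
  shows "k' b = k b" "pd j k' b = pd j k b" "pd i (pd j k') b = pd i (pd j k) b"
proof -
  note C = C[unfolded numeral_2_eq_2]
  have z: "\<delta> b = 0" "pd j \<delta> b = 0" "pd i (pd j \<delta>) b = 0" using fl by (auto simp: numeral_2_eq_2)
  show "k' b = k b" using R z by simp
  have 1: "pd j k' w = pd j k w + pd j \<delta> w" if "w \<in> R" for w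
  proof -
    have "pd j k' w = pd j (\<lambda>w. k w + \<delta> w) w" by (rule pd_cong_open[OF R(1) that R(3)])
    also have "\<dots> = pd j k w + pd j \<delta> w"
      unfolding pd_def[of j k] pd_def[of j \<delta>]
      by (rule pd_eq[OF has_derivative_add[OF C[THEN Ck_on_Suc_has_derivative, OF that]]])
    finally show ?thesis .
  qed
  show "pd j k' b = pd j k b" using 1[OF R(2)] z by simp
  have "pd i (pd j k') b = pd i (\<lambda>w. pd j k w + pd j \<delta> w) b" by (rule pd_cong_open[OF R(1,2) 1])
  also have "\<dots> = pd i (pd j k) b + pd i (pd j \<delta>) b"
    unfolding pd_def[of i "pd j k"] pd_def[of i "pd j \<delta>"]
    by (rule pd_eq[OF has_derivative_add[OF C[THEN Ck_on_pd, THEN Ck_on_Suc_has_derivative, OF R(2)]]])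
  finally show "pd i (pd j k') b = pd i (pd j k) b" using z by simp
qed

subsection \<open>The geodesic symmetry on a manifold\<close>

text \<open>The diagonal matrix of signs has nonzero determinant, and the determinant is
  multiplicative along the congruence.\<close>

lemma has_signature_invertible:
  fixes a :: "real^'n^'n"
  assumes "has_signature r s a" shows "invertible a"
proof -
  obtain P :: "real^'n^'n" and \<epsilon> where \<epsilon>: "\<forall>i. \<epsilon> i = 1 \<or> \<epsilon> i = -1"
    and P: "transpose P ** a ** P = (\<chi> i j. if i = j then \<epsilon> i else 0)"
    using assms unfolding has_signature_def by blast
  let ?D = "(\<chi> i j. if i = j then \<epsilon> i else 0) :: real^'n^'n"
  have "\<epsilon> i \<noteq> 0" for i using spec[OF \<epsilon>, of i] by auto
  moreover have "det ?D = (\<Prod>i\<in>UNIV. ?D $ i $ i)" by (rule det_diagonal) simp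
  ultimately have "det ?D \<noteq> 0" by simp
  then have "det (transpose P) * det a * det P \<noteq> 0" unfolding P[symmetric] det_mul .
  then show ?thesis unfolding invertible_det_nz by auto
qed

text \<open>The symmetry is built in the chart chosen at \<open>x\<close> and carried to the
  manifold. Equality of jets concerns every chart at \<open>x\<close>, and follows because the
  change of the metric in any of them is the pull-back of a flat change along a transition
  map.\<close>

lemma geodesic_symmetry_diffeo:
  assumes M: "smooth_manifold X A" and U: "openin X U" "x \<in> U" and g: "metric_on A r s U g"
  obtains V \<tau> where "diffeo X A V V \<tau>" "x \<in> V" "\<tau> x = x"
    "jac \<tau> (chart_at A x) (chart_at A x) x = - mat 1"
    "jet2 A (push_metric A V \<tau> g) x = jet2 A g x"
proof -
  \<comment> \<open>The chart through which \<open>push_tensor\<close> acts at \<open>x\<close>; as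
    \<open>x\<close> will be fixed, the Jacobian in this chart on both sides is the one needed
    later.\<close>
  define c0 where "c0 = chart_at A x"
  define \<phi> where "\<phi> = snd c0"
  define \<iota> where "\<iota> = cinv c0"
  have UX: "y \<in> topspace X" if "y \<in> U" for y using openin_subset[OF U(1)] that by blast
  have c0: "c0 \<in> A" "x \<in> fst c0"
    using chart_at_in[OF M UX[OF U(2)]] by (simp_all add: c0_def charts_at_def)
  define S where "S = \<phi> ` (U \<inter> fst c0)"
  define a where "a = \<phi> x"
  define h where "h y = g (\<iota> y) c0" for y
  have \<phi>\<iota>: "\<iota> y \<in> fst c0" "\<phi> (\<iota> y) = y" if "y \<in> \<phi> ` fst c0" for y
    using cinv_chart[of y c0] that unfolding \<phi>_def \<iota>_def by blast+
  have \<iota>\<phi>: "\<iota> (\<phi> y) = y" if "y \<in> fst c0" for y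
    using chart_cinv[OF M c0(1) that] by (simp add: \<phi>_def \<iota>_def)
  have S: "open S" "a \<in> S" "S \<subseteq> \<phi> ` fst c0"
    using open_chart_image[OF M c0(1) U(1)] U(2) c0(2) by (auto simp: S_def \<phi>_def a_def)
  have \<iota>S: "\<iota> y \<in> U" if "y \<in> S" for y using that \<iota>\<phi> by (auto simp: S_def)
  have g_mat: "transpose (g y c) = g y c" "has_signature r s (g y c)" if "y \<in> U" "c \<in> charts_at A y" for y c
    using g that unfolding metric_on_def by blast+
  have g_trans: "g y c = transpose (jac id c d y) ** g y d ** jac id c d y"
    if "y \<in> U" "c \<in> charts_at A y" "d \<in> charts_at A y" for y c d
    using g that unfolding metric_on_def by blast
  have g_smooth: "smooth_on (snd c ` (U \<inter> fst c)) (\<lambda>y. g (cinv c y) c)" if "c \<in> A" for c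
    using g that unfolding metric_on_def by blast
  have hS: "smooth_on S h" using g_smooth[OF c0(1)] by (simp add: h_def[abs_def] S_def \<phi>_def \<iota>_def)
  have c0y: "c0 \<in> charts_at A (\<iota> y)" if "y \<in> S" for y
    using \<phi>\<iota>(1) S(3) c0(1) that by (auto simp: charts_at_def)
  have "transpose (h y) = h y" "invertible (h y)" if "y \<in> S" for y
    using g_mat[OF \<iota>S[OF that] c0y[OF that]] has_signature_invertible unfolding h_def by blast+
  then obtain V0 \<theta> where V0: "open V0" "a \<in> V0" "V0 \<subseteq> S" "\<theta> ` V0 \<subseteq> V0" "\<And>u. u \<in> V0 \<Longrightarrow> \<theta> (\<theta> u) = u"
    and \<theta>: "smooth_on V0 \<theta>" "\<theta> a = a" "jmat \<theta> a = - mat 1" "flat 2 (\<lambda>u. pullback \<theta> h u - h u) a"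
    using geodesic_symmetry[OF S(1,2) hS] S(2) by blast

  define V where "V = \<iota> ` V0"
  define \<tau> where "\<tau> y = \<iota> (\<theta> (\<phi> y))" for y
  have V: "y \<in> fst c0" "y \<in> U" "\<phi> y \<in> V0" "\<theta> (\<phi> y) \<in> V0" if "y \<in> V" for y
  proof -
    obtain v where v: "v \<in> V0" "y = \<iota> v" using \<open>y \<in> V\<close> unfolding V_def by blast
    have vS: "v \<in> S" "v \<in> \<phi> ` fst c0" using v V0(3) S(3) by blast+
    show "y \<in> fst c0" "y \<in> U" "\<phi> y \<in> V0" using \<phi>\<iota>[OF vS(2)] \<iota>S[OF vS(1)] v by auto
    then show "\<theta> (\<phi> y) \<in> V0" using V0(4) by blast
  qed
  have V0S: "v \<in> S" "v \<in> \<phi> ` fst c0" if "v \<in> V0" for v using that V0(3) S(3) by blast+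
  have \<tau>V: "\<tau> y \<in> V" "\<phi> (\<tau> y) = \<theta> (\<phi> y)" "\<tau> (\<tau> y) = y" if "y \<in> V" for y
  proof -
    show "\<tau> y \<in> V" using V(4)[OF that] unfolding \<tau>_def V_def by blast
    show e: "\<phi> (\<tau> y) = \<theta> (\<phi> y)" using \<phi>\<iota>(2)[OF V0S(2)[OF V(4)[OF that]]] by (simp add: \<tau>_def)
    show "\<tau> (\<tau> y) = y"
      using V0(5)[OF V(3)[OF that]] \<iota>\<phi>[OF V(1)[OF that]] e unfolding \<tau>_def[of "\<tau> y"] by simp
  qed
  have xV: "x \<in> V" using V0(2) \<iota>\<phi>[OF c0(2)] unfolding V_def a_def by force
  have \<tau>x: "\<tau> x = x" using \<theta>(2) \<iota>\<phi>[OF c0(2)] by (simp add: \<tau>_def a_def)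
  have oV: "openin X V"
    unfolding V_def \<iota>_def using open_cinv_image[OF M c0(1) V0(1)] V0S(2) by (auto simp: \<phi>_def)
  \<comment> \<open>In \<open>c0\<close> the map is \<open>\<theta>\<close>, so the preimage is the
    image under \<open>\<iota>\<close> of an open subset of \<open>V0\<close>.\<close>
  have pre: "openin X {y \<in> V. \<tau> y \<in> T}" if T: "openin X T" for T
  proof -
    have o: "open (\<phi> ` (T \<inter> fst c0))" using open_chart_image[OF M c0(1) T] by (simp add: \<phi>_def)
    have "continuous_on V0 \<theta>" using \<theta>(1) unfolding smooth_on_def by (metis Ck_on.simps(1))
    then have o': "open (\<theta> -` (\<phi> ` (T \<inter> fst c0)) \<inter> V0)"
      using continuous_on_open_vimage[OF V0(1)] o by blast
    have "\<iota> ` (\<theta> -` (\<phi> ` (T \<inter> fst c0)) \<inter> V0) = {y \<in> V. \<tau> y \<in> T}"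
    proof (intro equalityI subsetI)
      fix y assume "y \<in> \<iota> ` (\<theta> -` (\<phi> ` (T \<inter> fst c0)) \<inter> V0)"
      then obtain v t where v: "y = \<iota> v" "v \<in> V0" "\<theta> v = \<phi> t" "t \<in> T" "t \<in> fst c0" by auto
      have "\<tau> y = t" using \<phi>\<iota>(2)[OF V0S(2)[OF v(2)]] \<iota>\<phi>[OF v(5)] v(1,3) by (simp add: \<tau>_def)
      then show "y \<in> {y \<in> V. \<tau> y \<in> T}" using v unfolding V_def by blast
    next
      fix y assume y: "y \<in> {y \<in> V. \<tau> y \<in> T}"
      then have yV: "y \<in> V" and yT: "\<tau> y \<in> T" by auto
      have "\<theta> (\<phi> y) \<in> \<phi> ` (T \<inter> fst c0)"
        unfolding \<tau>V(2)[OF yV, symmetric] using yT V(1)[OF \<tau>V(1)[OF yV]] by blast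
      then have "\<phi> y \<in> \<theta> -` (\<phi> ` (T \<inter> fst c0)) \<inter> V0" using V(3)[OF yV] by blast
      then have "\<iota> (\<phi> y) \<in> \<iota> ` (\<theta> -` (\<phi> ` (T \<inter> fst c0)) \<inter> V0)" by (rule imageI)
      then show "y \<in> \<iota> ` (\<theta> -` (\<phi> ` (T \<inter> fst c0)) \<inter> V0)" unfolding \<iota>\<phi>[OF V(1)[OF yV]] .
    qed
    moreover have "\<theta> -` (\<phi> ` (T \<inter> fst c0)) \<inter> V0 \<subseteq> snd c0 ` fst c0"
      using V0S(2) unfolding \<phi>_def by blast
    ultimately show ?thesis
      using open_cinv_image[OF M c0(1) o'] unfolding \<iota>_def by simp
  qed

  define Q where "Q c d = snd c ` {y \<in> V. y \<in> fst c \<and> \<tau> y \<in> fst d}" for c d :: "('a, 'b) chart"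
  have Qo: "open (Q c d)" if "c \<in> A" "d \<in> A" for c d
  proof -
    have "{y \<in> V. y \<in> fst c \<and> \<tau> y \<in> fst d} = {y \<in> V. \<tau> y \<in> fst d} \<inter> fst c" by auto
    then show ?thesis
      unfolding Q_def using open_chart_image[OF M that(1) pre[OF chart_open[OF M that(2)]]] by simp
  qed
  have \<tau>_smooth: "smooth_on (Q c d) (\<lambda>z. snd d (\<tau> (cinv c z)))" if c: "c \<in> A" "d \<in> A" for c d
  proof -
    have Qz: "cinv c z \<in> V" "cinv c z \<in> fst c" "\<tau> (cinv c z) \<in> fst d" "snd c (cinv c z) = z" if "z \<in> Q c d" for z
      using that chart_cinv[OF M c(1)] unfolding Q_def by auto
    \<comment> \<open>Between arbitrary charts \<open>\<tau>\<close> factors as the transition to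
      \<open>c0\<close>, then \<open>\<theta>\<close>, then the transition from
      \<open>c0\<close>.\<close>
    let ?F = "\<lambda>z. \<phi> (cinv c z)"
    have F: "smooth_on (Q c d) ?F"
    proof (rule smooth_on_restrict[OF transition_smooth[OF M c(1) c0(1), folded \<phi>_def]])
      show "Q c d \<subseteq> snd c ` (fst c \<inter> fst c0)" unfolding Q_def using V(1) by blast
    qed
    have FV: "?F ` Q c d \<subseteq> V0" using V(3) Qz(1) by blast
    have "smooth_on (Q c d) (\<lambda>z. \<theta> (?F z))"
      by (rule smooth_on_compose[OF Qo[OF c] V0(1) FV \<theta>(1) F])
    moreover have "(\<lambda>z. \<theta> (?F z)) ` Q c d \<subseteq> \<phi> ` (fst c0 \<inter> fst d)"
    proof (intro subsetI, elim imageE)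
      fix w z assume w: "w = \<theta> (?F z)" and z: "z \<in> Q c d"
      have "w = \<phi> (\<tau> (cinv c z))" using \<tau>V(2)[OF Qz(1)[OF z]] w by simp
      then show "w \<in> \<phi> ` (fst c0 \<inter> fst d)" using V(1)[OF \<tau>V(1)[OF Qz(1)[OF z]]] Qz(3)[OF z] by blast
    qed
    ultimately have "smooth_on (Q c d) (\<lambda>z. snd d (\<iota> (\<theta> (?F z))))"
      using smooth_on_compose[OF Qo[OF c] transition_domain_open[OF M c0(1) c(2), folded \<phi>_def] _
          transition_smooth[OF M c0(1) c(2), folded \<phi>_def \<iota>_def]] by blast
    then show ?thesis by (simp add: \<tau>_def)
  qed
  have sm: "smooth_map_on A V \<tau>"
    unfolding smooth_map_on_def using \<tau>_smooth[unfolded Q_def] by (auto simp: o_def)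
  have diff: "diffeo X A V V \<tau>"
    by (rule diffeo_involution[OF M oV _ \<tau>V(3) pre sm]) (use \<tau>V(1) in auto)

  have V0\<tau>: "\<phi> (\<tau> (\<iota> v)) = \<theta> v" if "v \<in> V0" for v
    using \<phi>\<iota>(2)[OF V0S(2)[OF that]] \<tau>V(2)[of "\<iota> v"] that unfolding V_def by simp
  have jac_x: "jac \<tau> c0 c0 x = - mat 1"
  proof -
    have "jac \<tau> c0 c0 x = jmat (\<lambda>v. \<phi> (\<tau> (\<iota> v))) a" by (simp add: jac_jmat \<phi>_def \<iota>_def a_def)
    also have "\<dots> = jmat \<theta> a" by (rule jmat_cong_open[OF V0(1,2) V0\<tau>])
    finally show ?thesis using \<theta>(3) by simp
  qed

  define g' where "g' = push_metric A V \<tau> g"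
  have inv: "inv_into V \<tau> y = \<tau> y" if "y \<in> V" for y
    by (rule involution_inv_into[OF _ \<tau>V(3) that]) (use \<tau>V(1) in auto)
  \<comment> \<open>\<open>push_metric\<close> evaluates \<open>g\<close> in
    \<open>chart_at A (\<tau> y)\<close>, a choice that may jump with \<open>y\<close>, so its
    formula cannot be differentiated directly. The transformation law of \<open>g\<close> trades
    this choice for the fixed chart \<open>c0\<close>.\<close>
  have push: "g' y d = transpose (jac \<tau> d c0 y) ** g (\<tau> y) c0 ** jac \<tau> d c0 y"
    if y: "y \<in> V" and d: "d \<in> A" "y \<in> fst d" for y d
  proof -
    let ?z = "\<tau> y"
    define c where "c = chart_at A ?z"
    have zU: "?z \<in> U" and z0: "?z \<in> fst c0" using V(1,2)[OF \<tau>V(1)[OF y]] by blast+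
    have cz: "c \<in> charts_at A ?z" unfolding c_def by (rule chart_at_in[OF M UX[OF zU]])
    then have c: "c \<in> A" "?z \<in> fst c" by (simp_all add: charts_at_def)
    have c0z: "c0 \<in> charts_at A ?z" using c0(1) z0 by (simp add: charts_at_def)
    let ?w = "snd d y"
    have yw: "cinv d ?w = y" by (rule chart_cinv[OF M d])
    have wQ: "?w \<in> Q d c" "?w \<in> Q d c0" unfolding Q_def using y d(2) c(2) z0 by blast+
    have dz: "cinv d w \<in> V" "cinv d w \<in> fst d" "\<tau> (cinv d w) \<in> fst c" if "w \<in> Q d c" for w
      using that chart_cinv[OF M d(1)] unfolding Q_def by auto
    have "jac (inv_into V \<tau>) d c y = jmat (\<lambda>w. snd c (inv_into V \<tau> (cinv d w))) ?w" by (rule jac_jmat)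
    \<comment> \<open>Inserting the identity \<open>\<iota> (\<phi> _)\<close> exhibits the
      transition from \<open>c0\<close> to \<open>c\<close>, which the chain rule then splits
      off.\<close>
    also have "\<dots> = jmat (\<lambda>w. snd c (\<iota> (\<phi> (\<tau> (cinv d w))))) ?w"
    proof (rule jmat_cong_open[OF Qo[OF d(1) c(1)] wQ(1)])
      fix w assume "w \<in> Q d c"
      then show "snd c (inv_into V \<tau> (cinv d w)) = snd c (\<iota> (\<phi> (\<tau> (cinv d w))))"
        using inv[OF dz(1)] \<iota>\<phi>[OF V(1)[OF \<tau>V(1)[OF dz(1)]]] by simp
    qed
    also have "\<dots> = jmat (\<lambda>v. snd c (\<iota> v)) (\<phi> (\<tau> (cinv d ?w))) ** jmat (\<lambda>w. \<phi> (\<tau> (cinv d w))) ?w"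
    proof (rule jmat_compose)
      show "(\<lambda>w. \<phi> (\<tau> (cinv d w))) differentiable (at ?w)"
        using smooth_on_differentiable[OF \<tau>_smooth[OF d(1) c0(1)] wQ(2)] by (simp add: \<phi>_def)
      show "(\<lambda>v. snd c (\<iota> v)) differentiable (at (\<phi> (\<tau> (cinv d ?w))))"
        using smooth_on_differentiable[OF transition_smooth[OF M c0(1) c(1)], of "\<phi> ?z"] z0 c(2)
        by (simp add: yw \<phi>_def \<iota>_def)
    qed
    also have "\<dots> = jac id c0 c ?z ** jac \<tau> d c0 y"
      by (simp add: jac_jmat yw \<phi>_def \<iota>_def)
    finally have J: "jac (inv_into V \<tau>) d c y = jac id c0 c ?z ** jac \<tau> d c0 y" .
    have "g' y d = transpose (jac (inv_into V \<tau>) d c y) ** g ?z c ** jac (inv_into V \<tau>) d c y"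
      by (simp add: g'_def push_metric_def Let_def inv[OF y] c_def)
    also have "\<dots> = transpose (jac \<tau> d c0 y) ** (transpose (jac id c0 c ?z) ** g ?z c ** jac id c0 c ?z) ** jac \<tau> d c0 y"
      unfolding J matrix_transpose_mul by (simp add: matrix_mul_assoc)
    finally show ?thesis unfolding g_trans[OF zU c0z cz, symmetric] .
  qed

  \<comment> \<open>The change of the metric in \<open>c0\<close>; its vanishing 2-jet at
    \<open>a\<close> is what gets transported to the other charts.\<close>
  define \<delta>0 where "\<delta>0 u = pullback \<theta> h u - h u" for u
  have Ch: "Ck_on k V0 h" and C\<theta>: "Ck_on k V0 \<theta>" for k
    using smooth_on_restrict[OF hS V0(3)] \<theta>(1) by (simp_all add: smooth_on_def)
  have C\<delta>0: "Ck_on k V0 \<delta>0" for k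
  proof -
    have "Ck_on k V0 (\<lambda>u. pullback \<theta> h u + - h u)"
      by (rule Ck_on_add[OF V0(1) Ck_on_pullback[OF V0(1) V0(1) V0(4) C\<theta> Ch]
            Ck_on_linear[OF bounded_linear_minus[OF bounded_linear_ident] V0(1) Ch]])
    then show ?thesis by (simp add: \<delta>0_def[abs_def])
  qed
  have jets: "g' (cinv d (snd d x)) d = g (cinv d (snd d x)) d \<and>
      pd j (\<lambda>w. g' (cinv d w) d) (snd d x) = pd j (\<lambda>w. g (cinv d w) d) (snd d x) \<and>
      pd i (pd j (\<lambda>w. g' (cinv d w) d)) (snd d x) = pd i (pd j (\<lambda>w. g (cinv d w) d)) (snd d x)"
    if "d \<in> charts_at A x" for d i j
  proof -
    have d: "d \<in> A" "x \<in> fst d" using that by (simp_all add: charts_at_def)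
    define R where "R = snd d ` (V \<inter> fst d)"
    define F where "F w = \<phi> (cinv d w)" for w
    have R: "open R" "snd d x \<in> R"
      unfolding R_def using open_chart_image[OF M d(1) oV] xV d(2) by auto
    have Rw: "cinv d w \<in> V" "cinv d w \<in> fst d" "snd d (cinv d w) = w" if "w \<in> R" for w
      using that chart_cinv[OF M d(1)] unfolding R_def by auto
    have "smooth_on R F"
      unfolding F_def[abs_def]
    proof (rule smooth_on_restrict[OF transition_smooth[OF M d(1) c0(1), folded \<phi>_def]])
      show "R \<subseteq> snd d ` (fst d \<inter> fst c0)" unfolding R_def using V(1) by blast
    qed
    then have CF: "Ck_on k R F" for k by (simp add: smooth_on_def)
    have FR: "F ` R \<subseteq> V0" using Rw(1) V(3) by (auto simp: F_def)
    have Fd: "F differentiable (at w)" if "w \<in> R" for w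
      using smooth_on_differentiable[OF \<open>smooth_on R F\<close> that] .
    have \<theta>d: "\<theta> differentiable (at v)" if "v \<in> V0" for v
      using smooth_on_differentiable[OF \<theta>(1) that] .
    \<comment> \<open>In the chart \<open>d\<close> both metrics are pull-backs along the same
      transition map \<open>F\<close>, so their difference is the pull-back of
      \<open>\<delta>0\<close>.\<close>
    have eq: "g' (cinv d w) d = g (cinv d w) d + pullback F \<delta>0 w" if w: "w \<in> R" for w
    proof -
      let ?y = "cinv d w"
      have y: "?y \<in> V" "?y \<in> fst d" "?y \<in> fst c0" "?y \<in> U" using Rw(1,2)[OF w] V(1,2) by blast+
      have ch: "d \<in> charts_at A ?y" "c0 \<in> charts_at A ?y" using y d(1) c0(1) by (simp_all add: charts_at_def)
      have "jac id d c0 ?y = jmat F w"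
        by (simp add: jac_jmat Rw(3)[OF w] F_def[abs_def] \<phi>_def)
      moreover have "h (F w) = g ?y c0" using \<iota>\<phi>[OF y(3)] by (simp add: h_def F_def)
      ultimately have 1: "g ?y d = pullback F h w"
        using g_trans[OF y(4) ch] by (simp add: pullback_def)
      have Fw: "F w \<in> V0" using FR w by blast
      have "jac \<tau> d c0 ?y = jmat (\<lambda>w. \<phi> (\<tau> (cinv d w))) w"
        by (simp add: jac_jmat Rw(3)[OF w] \<phi>_def)
      also have "\<dots> = jmat (\<lambda>w. \<theta> (F w)) w"
        by (rule jmat_cong_open[OF R(1) w]) (simp add: \<tau>V(2)[OF Rw(1)] F_def)
      finally have "jac \<tau> d c0 ?y = jmat (\<lambda>w. \<theta> (F w)) w" .
      moreover have "h (\<theta> (F w)) = g (\<tau> ?y) c0" by (simp add: h_def F_def \<tau>_def)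
      ultimately have "g' ?y d = pullback (\<lambda>w. \<theta> (F w)) h w"
        using push[OF y(1) d(1) y(2)] by (simp add: pullback_def)
      also have "\<dots> = pullback F (pullback \<theta> h) w"
        by (rule pullback_compose[OF Fd[OF w] \<theta>d[OF Fw], symmetric])
      finally have 2: "g' ?y d = pullback F (pullback \<theta> h) w" .
      show ?thesis unfolding 1 2 \<delta>0_def[abs_def] pullback_diff by simp
    qed
    have Ck: "Ck_on 2 R (\<lambda>w. g (cinv d w) d)"
    proof -
      have "R \<subseteq> snd d ` (U \<inter> fst d)" unfolding R_def using V(2) by blast
      from smooth_on_restrict[OF g_smooth[OF d(1)] this] show ?thesis by (simp add: smooth_on_def)
    qed
    have C\<delta>: "Ck_on 2 R (pullback F \<delta>0)" by (rule Ck_on_pullback[OF R(1) V0(1) FR CF C\<delta>0])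
    have "F (snd d x) = a" by (simp add: F_def a_def chart_cinv[OF M d])
    then have fl: "flat 2 (pullback F \<delta>0) (snd d x)"
      using flat_pullback[OF R(1) V0(1) FR R(2) CF C\<delta>0] \<theta>(4) by (simp add: \<delta>0_def[abs_def])
    from flat_imp_equal_derivatives[OF R eq Ck C\<delta> fl] show ?thesis by simp
  qed
  have "jet2 A g' x = jet2 A g x"
    unfolding jet2_def Let_def prod.inject
  proof (intro conjI refl ext)
    fix d
    show "(if d \<in> charts_at A x then (g' (cinv d (snd d x)) d, \<chi> k. pd k (\<lambda>y. g' (cinv d y) d) (snd d x),
          \<chi> k l. pd k (pd l (\<lambda>y. g' (cinv d y) d)) (snd d x)) else 0) =
        (if d \<in> charts_at A x then (g (cinv d (snd d x)) d, \<chi> k. pd k (\<lambda>y. g (cinv d y) d) (snd d x),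
          \<chi> k l. pd k (pd l (\<lambda>y. g (cinv d y) d)) (snd d x)) else 0)"
      using jets[of d] by (cases "d \<in> charts_at A x") simp_all
  qed
  then show thesis
    using that[OF diff xV \<tau>x] jac_x unfolding g'_def c0_def by blast
qed

text \<open>Minus the identity is diagonal, so only the multi-index \<open>J = I\<close>
  contributes, with a factor -1 for each of the \<open>p\<close> slots.\<close>

lemma transform_uminus:
  assumes "length I = p" shows "transform p (- mat 1) t I = (-1) ^ p * t I"
proof -
  have "(\<Prod>k<p. (- mat 1) $ (I ! k) $ (J ! k)) * t J = (if J = I then (-1) ^ p * t I else 0)"
    if J: "length J = p" for J
  proof (cases "J = I")
    case True
    then show ?thesis by (simp add: mat_def)
  next
    case False
    then obtain k where "k < p" "I ! k \<noteq> J ! k" using assms J by (metis nth_equalityI)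
    then have "(\<Prod>k<p. (- mat 1 :: real^'a^'a) $ (I ! k) $ (J ! k)) = 0"
      by (intro prod_zero) (auto simp: mat_def)
    then show ?thesis using False by simp
  qed
  then have "transform p (- mat 1) t I = (\<Sum>J | length J = p. if J = I then (-1) ^ p * t I else 0)"
    unfolding transform_def by (intro sum.cong) auto
  also have "\<dots> = (-1) ^ p * t I"
    using assms finite_lists_length_eq[of "UNIV :: 'a set" p] by simp
  finally show ?thesis .
qed

text \<open>The transformation law is linear and determines all charts at \<open>x\<close> from one;
  the remaining arguments give 0 by the encoding of tensors.\<close>

lemma tensor_zeroI:
  assumes "t \<in> tensors_at A p x" "c \<in> charts_at A x" "\<And>I. length I = p \<Longrightarrow> t c I = 0"
  shows "t = (\<lambda>c I. 0)"
proof (intro ext)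
  fix d I
  show "t d I = 0"
  proof (cases "d \<in> charts_at A x \<and> length I = p")
    case True
    then have "t d I = transform p (jac id c d x) (t c) I"
      using assms(1,2) unfolding tensors_at_def by blast
    then show ?thesis by (simp add: transform_def assms(3))
  next
    case False
    then show ?thesis using assms(1) unfolding tensors_at_def by blast
  qed
qed

theorem mainTheorem6:
  fixes X :: "'a topology"
    and A :: "('a, 'n::finite) chart set"
    and r s p :: nat
    and T :: "('a, 'n) jet \<Rightarrow> ('a, 'n) tensor"
  assumes "smooth_manifold X A"
    and "r + s = CARD('n)"
    and "p \<ge> 1"
    and "second_order_tensor X A r s p T"
    and "nonzero_tensor X A r s T"
    and "natural X A r s p T"
    and "divergence_free X A r s p T"
  shows "even p"
proof (rule ccontr)
  assume odd: "odd p"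
  from \<open>nonzero_tensor X A r s T\<close> obtain U g x where U: "openin X U" "x \<in> U" and g: "metric_on A r s U g"
    and j: "jet2 A g x \<in> J2M X A r s" and nz: "T (jet2 A g x) \<noteq> (\<lambda>c I. 0)"
    unfolding nonzero_tensor_def J2M_def by blast
  let ?c = "chart_at A x" and ?t = "T (jet2 A g x)"
  have c: "?c \<in> charts_at A x"
    by (rule chart_at_in[OF assms(1)]) (use openin_subset[OF U(1)] U(2) in blast)
  obtain V \<tau> where \<tau>: "diffeo X A V V \<tau>" "x \<in> V" "\<tau> x = x" "jac \<tau> ?c ?c x = - mat 1"
    "jet2 A (push_metric A V \<tau> g) x = jet2 A g x"
    by (rule geodesic_symmetry_diffeo[OF assms(1) U g])
  have "T (jet2 A (push_metric A V \<tau> g) (\<tau> x)) = push_tensor A p \<tau> x ?t"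
    using assms(6) \<tau>(1,2) U g unfolding natural_def by blast
  \<comment> \<open>As \<open>x\<close> is fixed and the 2-jet is preserved, naturality becomes an
    equation for the single tensor \<open>?t\<close>.\<close>
  then have t: "?t = push_tensor A p \<tau> x ?t" unfolding \<tau>(3,5) .
  have "?t ?c I = 0" if I: "length I = p" for I
  proof -
    have "?t ?c I = push_tensor A p \<tau> x ?t ?c I" by (subst t) (rule refl)
    also have "\<dots> = (-1) ^ p * ?t ?c I"
      using c I by (simp add: push_tensor_def \<tau>(3,4) transform_uminus)
    \<comment> \<open>For odd \<open>p\<close> the component equals its own negative.\<close>
    finally show ?thesis using odd by simp
  qed
  moreover have "?t \<in> tensors_at A p x"
    using assms(4) j unfolding second_order_tensor_def by (auto simp: jet2_def)
  ultimately have "?t = (\<lambda>c I. 0)" by (intro tensor_zeroI[OF _ c])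
  with nz show False ..
qed

end
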